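(* Let $n\ge 3$. Any element of $G$ can be written uniquely in canonical form, that is, as a product $$x=R_1^{m}\,y_{(2)}\,y_{(3)}\cdots y_{(n-1)},\qquad m\in\{0,1,\dots,7\},$$ where for each $i\in\{2,\dots,n-1\}$ the factor $y_{(i)}$ is an expression of one of the following types: 1. $R_i^{k}$ with $k\in\{0,1,2,3\}$; 2. $R_iR_{i-1}\cdots R_{i-j}$ with $j\in\{1,\dots,i-1\}$; 3. $R_i^{3}R_{i-1}\cdots R_{i-j}$ with $j\in\{1,\dots,i-1\}$. The number of elements of $G$ is $2^n n!$.
   Context: $G$ is the group with generators $R_1,\dots,R_{n-1}$ and defining relations $R_iR_{i+1}R_i=R_{i+1}R_iR_{i+1}$ for $1\le i\le n-2$, $R_iR_j=R_jR_i$ for $|i-j|\ge 2$, and $R_1^{2}=R_2R_1^{2}R_2$. (In the paper $G$ arises as the group of homotopy classes of paths in $SO(n)$ from the identity to rotational symmetries of the hyperoctahedron, and is given by this presentation.) In expressions of type 3 the exponent $3$ applies only to $R_i$; the letters $R_{i-1},\dots,R_{i-j}$ each occur once, with decreasing indices. *)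

theory Defs
  imports "HOL-Algebra.Coset" "HOL-Library.FuncSet"
begin

section \<open>Groups given by generators and relations\<close>

text \<open>The letter \<open>(a, True)\<close> stands for the generator \<open>a\<close> and \<open>(a, False)\<close> for its inverse.
  A pair \<open>(u, v)\<close> of words is the relation \<open>u = v\<close>.\<close>

type_synonym 'a word = "('a \<times> bool) list"

definition words_over :: "'a set \<Rightarrow> 'a word set" where
  "words_over S = lists (S \<times> UNIV)"

inductive pres_cong :: "'a set \<Rightarrow> ('a word \<times> 'a word) set \<Rightarrow> 'a word \<Rightarrow> 'a word \<Rightarrow> bool"
  for S E where
  refl: "u \<in> words_over S \<Longrightarrow> pres_cong S E u u"
| sym: "pres_cong S E u v \<Longrightarrow> pres_cong S E v u"
| trans: "pres_cong S E u v \<Longrightarrow> pres_cong S E v w \<Longrightarrow> pres_cong S E u w"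
| mult: "pres_cong S E u u' \<Longrightarrow> pres_cong S E v v' \<Longrightarrow> pres_cong S E (u @ v) (u' @ v')"
| cancel: "a \<in> S \<Longrightarrow> pres_cong S E [(a, b), (a, \<not> b)] []"
| rel: "(u, v) \<in> E \<Longrightarrow> u \<in> words_over S \<Longrightarrow> v \<in> words_over S \<Longrightarrow> pres_cong S E u v"

definition pres_rel :: "'a set \<Rightarrow> ('a word \<times> 'a word) set \<Rightarrow> ('a word \<times> 'a word) set" where
  "pres_rel S E = {(u, v). pres_cong S E u v}"

definition presented_group :: "'a set \<Rightarrow> ('a word \<times> 'a word) set \<Rightarrow> 'a word set monoid" where
  "presented_group S E =
     \<lparr>carrier = words_over S // pres_rel S E,
      mult = (\<lambda>X Y. \<Union>u\<in>X. \<Union>v\<in>Y. pres_rel S E `` {u @ v}),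
      one = pres_rel S E `` {[]}\<rparr>"

definition pres_gen :: "'a set \<Rightarrow> ('a word \<times> 'a word) set \<Rightarrow> 'a \<Rightarrow> 'a word set" where
  "pres_gen S E a = pres_rel S E `` {[(a, True)]}"

definition list_prod :: "('a, 'b) monoid_scheme \<Rightarrow> 'a list \<Rightarrow> 'a" where
  "list_prod G xs = foldr (mult G) xs \<one>\<^bsub>G\<^esub>"

definition word_value :: "('b, 'c) monoid_scheme \<Rightarrow> ('a \<Rightarrow> 'b) \<Rightarrow> 'a word \<Rightarrow> 'b" where
  "word_value H f w = list_prod H (map (\<lambda>(a, b). if b then f a else inv\<^bsub>H\<^esub> (f a)) w)"


subsection \<open>The presented group is a group with the expected universal property\<close>

lemma words_over_simps [simp]:
  "[] \<in> words_over S"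
  "p # w \<in> words_over S \<longleftrightarrow> fst p \<in> S \<and> w \<in> words_over S"
  "u @ v \<in> words_over S \<longleftrightarrow> u \<in> words_over S \<and> v \<in> words_over S"
  by (auto simp: words_over_def mem_Times_iff)

lemma pres_cong_words:
  "pres_cong S E u v \<Longrightarrow> u \<in> words_over S \<and> v \<in> words_over S"
  by (induction rule: pres_cong.induct) auto

lemma equiv_pres_rel: "equiv (words_over S) (pres_rel S E)"
proof (rule equivI)
  show "pres_rel S E \<subseteq> words_over S \<times> words_over S"
    using pres_cong_words by (fastforce simp: pres_rel_def)
  show "refl_on (words_over S) (pres_rel S E)"
    using pres_cong.refl by (fastforce simp: refl_on_def pres_rel_def)
  show "sym (pres_rel S E)"
    using pres_cong.sym by (fastforce simp: sym_def pres_rel_def)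
  show "trans (pres_rel S E)"
    using pres_cong.trans by (fastforce simp: trans_def pres_rel_def)
qed

lemma pres_class_eq_iff:
  assumes "u \<in> words_over S" "v \<in> words_over S"
  shows "pres_rel S E `` {u} = pres_rel S E `` {v} \<longleftrightarrow> pres_cong S E u v"
  using eq_equiv_class_iff[OF equiv_pres_rel assms] by (simp add: pres_rel_def)

lemma pres_carrierE:
  assumes "X \<in> carrier (presented_group S E)"
  obtains u where "u \<in> words_over S" "X = pres_rel S E `` {u}"
  using assms by (auto simp: presented_group_def elim: quotientE)

lemma pres_class_in_carrier [simp]:
  "u \<in> words_over S \<Longrightarrow> pres_rel S E `` {u} \<in> carrier (presented_group S E)"
  by (simp add: presented_group_def quotientI)

lemma pres_one: "\<one>\<^bsub>presented_group S E\<^esub> = pres_rel S E `` {[]}"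
  by (simp add: presented_group_def)

lemma pres_mult:
  assumes "u \<in> words_over S" "v \<in> words_over S"
  shows "pres_rel S E `` {u} \<otimes>\<^bsub>presented_group S E\<^esub> pres_rel S E `` {v} = pres_rel S E `` {u @ v}"
proof -
  have "congruent2 (pres_rel S E) (pres_rel S E) (\<lambda>u v. pres_rel S E `` {u @ v})"
  proof (rule congruent2I')
    fix u u' v v' assume "(u, u') \<in> pres_rel S E" "(v, v') \<in> pres_rel S E"
    then have "pres_cong S E (u @ v) (u' @ v')"
      by (simp add: pres_rel_def pres_cong.mult)
    then show "pres_rel S E `` {u @ v} = pres_rel S E `` {u' @ v'}"
      using pres_class_eq_iff pres_cong_words by blast
  qed
  then show ?thesis
    using UN_equiv_class2[OF equiv_pres_rel equiv_pres_rel _ assms]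
    by (simp add: presented_group_def)
qed

lemma pres_left_inverse:
  "w \<in> words_over S \<Longrightarrow> \<exists>w'\<in>words_over S. pres_cong S E (w' @ w) []"
proof (induction w)
  case Nil
  then show ?case by (intro bexI[of _ "[]"]) (auto intro: pres_cong.refl)
next
  case (Cons p w)
  obtain a b where p: "p = (a, b)" by (cases p)
  from Cons have a: "a \<in> S" and w: "w \<in> words_over S" by (auto simp: p)
  from Cons w obtain w' where w': "w' \<in> words_over S" "pres_cong S E (w' @ w) []" by blast
  have "pres_cong S E ([(a, \<not> b), (a, b)] @ w) ([] @ w)"
    using pres_cong.cancel[OF a, of E "\<not> b"] by (intro pres_cong.mult pres_cong.refl w) simp
  then have "pres_cong S E (w' @ ([(a, \<not> b), (a, b)] @ w)) (w' @ ([] @ w))"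
    by (rule pres_cong.mult[OF pres_cong.refl[OF w'(1)]])
  then have "pres_cong S E ((w' @ [(a, \<not> b)]) @ p # w) []"
    using pres_cong.trans[OF _ w'(2)] by (simp add: p)
  then show ?case
    using w' a by (intro bexI[of _ "w' @ [(a, \<not> b)]"]) auto
qed

lemma group_presented_group: "group (presented_group S E)"
proof (rule groupI)
  fix X Y Z
  assume X: "X \<in> carrier (presented_group S E)"
  obtain u where u: "u \<in> words_over S" "X = pres_rel S E `` {u}" by (rule pres_carrierE[OF X])
  show "\<one>\<^bsub>presented_group S E\<^esub> \<otimes>\<^bsub>presented_group S E\<^esub> X = X"
    by (simp add: u pres_one pres_mult)
  obtain w where "w \<in> words_over S" "pres_cong S E (w @ u) []"
    using pres_left_inverse[OF u(1)] by blast
  then show "\<exists>Y\<in>carrier (presented_group S E). Y \<otimes>\<^bsub>presented_group S E\<^esub> X = \<one>\<^bsub>presented_group S E\<^esub>"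
    using u by (intro bexI[of _ "pres_rel S E `` {w}"]) (auto simp: pres_mult pres_one pres_class_eq_iff)
  assume Y: "Y \<in> carrier (presented_group S E)"
  obtain v where v: "v \<in> words_over S" "Y = pres_rel S E `` {v}" by (rule pres_carrierE[OF Y])
  show "X \<otimes>\<^bsub>presented_group S E\<^esub> Y \<in> carrier (presented_group S E)"
    using u v by (simp add: pres_mult)
  assume Z: "Z \<in> carrier (presented_group S E)"
  obtain w where w: "w \<in> words_over S" "Z = pres_rel S E `` {w}" by (rule pres_carrierE[OF Z])
  show "X \<otimes>\<^bsub>presented_group S E\<^esub> Y \<otimes>\<^bsub>presented_group S E\<^esub> Z
      = X \<otimes>\<^bsub>presented_group S E\<^esub> (Y \<otimes>\<^bsub>presented_group S E\<^esub> Z)"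
    using u v w by (simp add: pres_mult)
qed (simp add: pres_one)

lemma pres_gen_closed: "a \<in> S \<Longrightarrow> pres_gen S E a \<in> carrier (presented_group S E)"
  by (simp add: pres_gen_def)

lemma list_prod_simps [simp]:
  "list_prod G [] = \<one>\<^bsub>G\<^esub>"
  "list_prod G (x # xs) = x \<otimes>\<^bsub>G\<^esub> list_prod G xs"
  by (simp_all add: list_prod_def)

lemma word_value_simps [simp]:
  "word_value H f [] = \<one>\<^bsub>H\<^esub>"
  "word_value H f ((a, b) # w) = (if b then f a else inv\<^bsub>H\<^esub> (f a)) \<otimes>\<^bsub>H\<^esub> word_value H f w"
  by (simp_all add: word_value_def)

context
  fixes H (structure) and S :: "'a set" and E :: "('a word \<times> 'a word) set" and f
  assumes H: "group H" and f: "f \<in> S \<rightarrow> carrier H"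
begin

interpretation H: group H by (rule H)

lemma word_value_closed: "w \<in> words_over S \<Longrightarrow> word_value H f w \<in> carrier H"
  using f by (induction w) (auto simp: Pi_iff)

lemma word_value_append:
  assumes "u \<in> words_over S" "v \<in> words_over S"
  shows "word_value H f (u @ v) = word_value H f u \<otimes> word_value H f v"
  using assms f word_value_closed by (induction u) (auto simp: H.m_assoc Pi_iff)

lemma word_value_cong:
  assumes E: "\<And>u v. (u, v) \<in> E \<Longrightarrow> word_value H f u = word_value H f v"
  shows "pres_cong S E u v \<Longrightarrow> word_value H f u = word_value H f v"
proof (induction rule: pres_cong.induct)
  case (mult u u' v v')
  then show ?case using pres_cong_words word_value_append by metis
next
  case (cancel a b)
  then have "f a \<in> carrier H" using f by auto
  then show ?case by auto
qed (auto simp: E)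

lemma presented_group_universal:
  assumes E: "\<And>u v. (u, v) \<in> E \<Longrightarrow> word_value H f u = word_value H f v"
  shows "\<exists>h\<in>hom (presented_group S E) H. \<forall>a\<in>S. h (pres_gen S E a) = f a"
proof -
  define h where "h X = word_value H f (SOME u. u \<in> X)" for X
  have h: "h (pres_rel S E `` {u}) = word_value H f u" if u: "u \<in> words_over S" for u
  proof -
    have "u \<in> pres_rel S E `` {u}" by (simp add: pres_rel_def pres_cong.refl u)
    then have "(SOME v. v \<in> pres_rel S E `` {u}) \<in> pres_rel S E `` {u}" by (rule someI)
    then have "pres_cong S E u (SOME v. v \<in> pres_rel S E `` {u})" by (simp add: pres_rel_def)
    from word_value_cong[OF E this] show ?thesis by (simp add: h_def)
  qed
  have "h \<in> hom (presented_group S E) H"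
    by (rule homI) (auto elim!: pres_carrierE simp: h pres_mult word_value_closed word_value_append)
  moreover have "h (pres_gen S E a) = f a" if "a \<in> S" for a
    using that f by (auto simp: pres_gen_def h Pi_iff)
  ultimately show ?thesis by blast
qed

end


section \<open>The group \<open>G\<close> and its canonical forms\<close>

definition pos_word :: "'a list \<Rightarrow> 'a word" where
  "pos_word w = map (\<lambda>a. (a, True)) w"

definition G_relations :: "nat \<Rightarrow> (nat word \<times> nat word) set" where
  "G_relations n =
     {(pos_word [i, i + 1, i], pos_word [i + 1, i, i + 1]) | i. i \<in> {1..n - 2}}
   \<union> {(pos_word [i, j], pos_word [j, i]) | i j.
        i \<in> {1..n - 1} \<and> j \<in> {1..n - 1} \<and> \<bar>int i - int j\<bar> \<ge> 2}
   \<union> {(pos_word [1, 1], pos_word [2, 1, 1, 2])}"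

definition G_group :: "nat \<Rightarrow> nat word set monoid" where
  "G_group n = presented_group {1..n - 1} (G_relations n)"

definition G_gen :: "nat \<Rightarrow> nat \<Rightarrow> nat word set" where
  "G_gen n i = pres_gen {1..n - 1} (G_relations n) i"

text \<open>The expressions allowed as the factor \<open>y\<^sub>(\<^sub>i\<^sub>)\<close>, as words in the indices of the generators;
  \<open>rev [i - j..<i]\<close> is the decreasing list \<open>[i - 1, \<dots>, i - j]\<close>.\<close>

definition factor_expressions :: "nat \<Rightarrow> nat list set" where
  "factor_expressions i =
     {replicate k i | k. k \<in> {0..3}}
   \<union> {[i] @ rev [i - j..<i] | j. j \<in> {1..i - 1}}
   \<union> {[i, i, i] @ rev [i - j..<i] | j. j \<in> {1..i - 1}}"

text \<open>A canonical form is the exponent \<open>m\<close> together with the family of expressions \<open>y\<close>, so that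
  uniqueness refers to expressions and not merely to the group elements they denote. The
  extensional product \<open>\<Pi>\<^sub>E\<close> fixes the irrelevant values of \<open>y\<close> outside \<open>{2..n - 1}\<close>.\<close>

definition canonical_forms :: "nat \<Rightarrow> (nat \<times> (nat \<Rightarrow> nat list)) set" where
  "canonical_forms n = {0..7} \<times> (\<Pi>\<^sub>E i\<in>{2..n - 1}. factor_expressions i)"

definition expression_value :: "nat \<Rightarrow> nat list \<Rightarrow> nat word set" where
  "expression_value n w = list_prod (G_group n) (map (G_gen n) w)"

definition canonical_value :: "nat \<Rightarrow> nat \<times> (nat \<Rightarrow> nat list) \<Rightarrow> nat word set" where
  "canonical_value n = (\<lambda>(m, y).
     G_gen n 1 [^]\<^bsub>G_group n\<^esub> m \<otimes>\<^bsub>G_group n\<^esub>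
     list_prod (G_group n) (map (\<lambda>i. expression_value n (y i)) [2..<n]))"

end

theory Submission
  imports Defs "HOL-Algebra.Generated_Groups" "HOL-Algebra.Bij" "HOL-Algebra.Multiplicative_Group"
    "HOL-Computational_Algebra.Primes" Complex_Main
begin

text \<open>Write \<open>H\<^sub>k\<close> for the subgroup generated by \<open>R\<^sub>1, \<dots>, R\<^sub>k\<close>. The model to keep in mind is the group generated
  by quarter turns \<open>e\<^sub>i \<mapsto> e\<^sub>i\<^sub>+\<^sub>1 \<mapsto> - e\<^sub>i\<close> of \<open>\<real>\<^sup>n\<close>, of which \<open>G\<close> is a double cover: there \<open>H\<^sub>k\<^sub>-\<^sub>1\<close> fixes
  \<open>e\<^sub>k\<^sub>+\<^sub>1\<close>, and \<open>H\<^sub>k\<close> moves it through the \<open>2 (k + 1)\<close> vectors \<open>\<plusminus>e\<^sub>1, \<dots>, \<plusminus>e\<^sub>k\<^sub>+\<^sub>1\<close>. The allowed factors \<open>y\<^sub>(\<^sub>k\<^sub>)\<close> are the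
  descending words \<open>R\<^sub>k R\<^sub>k\<^sub>-\<^sub>1 \<dots> R\<^sub>p\<close> and \<open>R\<^sub>k\<^sup>2 R\<^sub>k R\<^sub>k\<^sub>-\<^sub>1 \<dots> R\<^sub>p\<close> with \<open>1 \<le> p \<le> k + 1\<close> (for \<open>p = k + 1\<close> and \<open>p = k\<close>
  they are the powers of \<open>R\<^sub>k\<close>), so there are \<open>2 (k + 1)\<close> of them, and in the model they correspond to
  the vectors \<open>\<plusminus>e\<^sub>p\<close>. The claim is that they represent the cosets of \<open>H\<^sub>k\<^sub>-\<^sub>1\<close> in \<open>H\<^sub>k\<close>.

  Existence. The relation \<open>R\<^sub>1\<^sup>2 = R\<^sub>2 R\<^sub>1\<^sup>2 R\<^sub>2\<close> is carried by the braid relations to every pair of adjacent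
  generators, in both orders. Hence conjugation by the square of a generator inverts its neighbours,
  the fourth powers of all generators coincide, and \<open>R\<^sub>i\<^sup>8 = 1\<close>. With these rules every product of a
  descending word with a generator can be rewritten as an element of \<open>H\<^sub>k\<^sub>-\<^sub>1\<close> or \<open>H\<^sub>k\<^sub>-\<^sub>1 R\<^sub>k\<^sup>2\<close> followed by a
  descending word, which gives \<open>parabolic_decomposition\<close> and, by induction on \<open>k\<close>,
  \<open>canonical_form_exists\<close>.

  Uniqueness. The quarter turns satisfy the relations of \<open>G\<close>. In a product \<open>R\<^sub>1\<^sup>m y\<^sub>(\<^sub>2\<^sub>) \<dots> y\<^sub>(\<^sub>k\<^sub>)\<close> the part before
  \<open>y\<^sub>(\<^sub>k\<^sub>)\<close> fixes \<open>e\<^sub>k\<^sub>+\<^sub>1\<close>, so the vector \<open>\<plusminus>e\<^sub>p\<close> that is sent to \<open>e\<^sub>k\<^sub>+\<^sub>1\<close> is read off from the product, and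
  it determines \<open>y\<^sub>(\<^sub>k\<^sub>)\<close>. Cancelling the factors one after the other leaves \<open>R\<^sub>1\<^sup>m\<close>. The quarter turns have
  order only 4; that \<open>R\<^sub>1\<close> has order 8 is seen in the spin representation \<open>R\<^sub>i \<mapsto> (1 + J\<^sub>i) / \<surd>2\<close>, where the
  \<open>J\<^sub>i\<close> are square roots of \<open>- 1\<close> that anticommute if adjacent and commute otherwise: there
  \<open>R\<^sub>1\<^sup>4\<close> acts as \<open>- 1\<close>. The order of \<open>G\<close> is then the number of canonical forms,
  \<open>8 \<Prod> 2 (i + 1)\<close> over \<open>2 \<le> i < n\<close>.\<close>

section \<open>Counting the canonical forms\<close>

text \<open>Reading all three types of factors as descending words, with or without an extra square in front,
  is what makes a uniform treatment possible: the second kind always arises from the first by left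
  multiplication with \<open>R\<^sub>k\<^sup>2\<close>.\<close>

lemma factor_expressions_eq:
  assumes "1 \<le> k"
  shows "factor_expressions k =
    (\<lambda>p. rev [p..<Suc k]) ` {1..Suc k} \<union> (\<lambda>p. k # k # rev [p..<Suc k]) ` {1..Suc k}"
proof -
  have *: "{0..3::nat} = {0,1,2,3}" by auto
  have pow: "{replicate j k | j. j \<in> {0..3}} =
      {rev [Suc k..<Suc k], rev [k..<Suc k], k # k # rev [Suc k..<Suc k], k # k # rev [k..<Suc k]}"
  proof -
    have "{replicate j k | j. j \<in> {0..3}} = (\<lambda>j. replicate j k) ` {0, 1, 2, 3}"
      unfolding * by blast
    then show ?thesis using assms by (simp add: numeral_2_eq_2 numeral_3_eq_3 insert_commute)
  qed
  have reflect: "(\<lambda>j. k - j) ` {1..k - 1} = {1..<k}"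
  proof (intro equalityI subsetI)
    fix x assume "x \<in> {1..<k}"
    then show "x \<in> (\<lambda>j. k - j) ` {1..k - 1}" by (intro image_eqI[of _ _ "k - x"]) auto
  qed auto
  have P: "{[k] @ rev [k - j..<k] | j. j \<in> {1..k - 1}} = (\<lambda>p. rev [p..<Suc k]) ` {1..<k}"
  proof -
    have "{[k] @ rev [k - j..<k] | j. j \<in> {1..k - 1}} = (\<lambda>p. rev [p..<Suc k]) ` (\<lambda>j. k - j) ` {1..k - 1}"
      unfolding Setcompr_eq_image image_image by (rule image_cong) auto
    then show ?thesis unfolding reflect .
  qed
  have N: "{[k, k, k] @ rev [k - j..<k] | j. j \<in> {1..k - 1}} = (\<lambda>p. k # k # rev [p..<Suc k]) ` {1..<k}"
  proof -
    have "{[k, k, k] @ rev [k - j..<k] | j. j \<in> {1..k - 1}} = (\<lambda>p. k # k # rev [p..<Suc k]) ` (\<lambda>j. k - j) ` {1..k - 1}"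
      unfolding Setcompr_eq_image image_image by (rule image_cong) auto
    then show ?thesis unfolding reflect .
  qed
  have "{1..Suc k} = {1..<k} \<union> {k, Suc k}" using assms by auto
  then show ?thesis
    unfolding factor_expressions_def pow P N by auto
qed

lemma factor_expressions_subset:
  assumes "1 \<le> k" "w \<in> factor_expressions k"
  shows "set w \<subseteq> {1..k}"
  using assms unfolding factor_expressions_eq[OF assms(1)] by (auto simp del: upt_Suc)

lemma card_factor_expressions:
  assumes "1 \<le> k"
  shows "card (factor_expressions k) = 2 * (k + 1)"
proof -
  have inj: "inj_on (\<lambda>p. rev [p..<Suc k]) {1..Suc k}"
  proof (rule inj_onI)
    fix p q assume "p \<in> {1..Suc k}" "q \<in> {1..Suc k}" "rev [p..<Suc k] = rev [q..<Suc k]"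
    then have "length (rev [p..<Suc k]) = length (rev [q..<Suc k])" by metis
    with \<open>p \<in> _\<close> \<open>q \<in> _\<close> show "p = q" by (auto simp del: upt_Suc)
  qed
  moreover have "inj_on (\<lambda>p. k # k # rev [p..<Suc k]) {1..Suc k}"
    using inj by (simp add: inj_on_def del: upt_Suc rev_is_rev_conv)
  \<comment> \<open>The words of the first kind have no repeated letters, those of the second kind begin with one.\<close>
  moreover have "(\<lambda>p. rev [p..<Suc k]) ` {1..Suc k} \<inter> (\<lambda>p. k # k # rev [p..<Suc k]) ` {1..Suc k} = {}"
  proof -
    have "distinct w" if "w \<in> (\<lambda>p. rev [p..<Suc k]) ` {1..Suc k}" for w
      using that by (auto simp del: upt_Suc)
    moreover have "\<not> distinct w" if "w \<in> (\<lambda>p. k # k # rev [p..<Suc k]) ` {1..Suc k}" for w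
      using that by auto
    ultimately show ?thesis by blast
  qed
  ultimately show ?thesis
    unfolding factor_expressions_eq[OF assms] by (simp add: card_Un_disjoint card_image del: upt_Suc)
qed

lemma card_canonical_forms:
  assumes "n \<ge> 2"
  shows "card (canonical_forms n) = 2 ^ n * fact n"
proof -
  have "(\<Prod>i\<in>{2..n - 1}. 2 * (i + 1)) * 8 = 2 ^ n * fact n"
    using assms
  proof (induction n rule: dec_induct)
    case (step n)
    then have "{2..Suc n - 1} = insert n {2..n - 1}" "n \<notin> {2..n - 1}" by auto
    with step.IH show ?case by (simp add: algebra_simps)
  qed simp
  moreover have "(\<Prod>i\<in>{2..n - 1}. card (factor_expressions i)) = (\<Prod>i\<in>{2..n - 1}. 2 * (i + 1))"
    by (rule prod.cong) (auto simp: card_factor_expressions)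
  ultimately show ?thesis
    by (simp add: canonical_forms_def card_cartesian_product card_PiE)
qed

text \<open>A canonical form spelled out as one word in the indices of the generators, truncated at the index
  \<open>k\<close> so that inductions on \<open>k\<close> are possible.\<close>

definition canonical_word :: "nat \<Rightarrow> nat \<Rightarrow> (nat \<Rightarrow> nat list) \<Rightarrow> nat list" where
  "canonical_word k m y = replicate m 1 @ concat (map y [2..<Suc k])"

lemma canonical_word_Suc:
  "1 \<le> k \<Longrightarrow> canonical_word (Suc k) m y = canonical_word k m y @ y (Suc k)"
  by (simp add: canonical_word_def)

lemma set_canonical_word:
  assumes "1 \<le> k" "\<And>i. i \<in> {2..k} \<Longrightarrow> y i \<in> factor_expressions i"
  shows "set (canonical_word k m y) \<subseteq> {1..k}"
proof -
  have "set (y i) \<subseteq> {1..k}" if "i \<in> {2..k}" for i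
    using factor_expressions_subset[of i "y i"] assms(2)[OF that] that by fastforce
  then have "(\<Union>i\<in>{2..k}. set (y i)) \<subseteq> {1..k}" by blast
  then show ?thesis using assms(1)
    by (simp add: canonical_word_def atLeastLessThanSuc_atLeastAtMost set_replicate_conv_if del: upt_Suc)
qed

section \<open>Products and generated subgroups\<close>

lemma (in group) list_prod_closed:
  "set xs \<subseteq> carrier G \<Longrightarrow> list_prod G xs \<in> carrier G"
  by (induction xs) auto

lemma (in group) list_prod_append:
  "set xs \<subseteq> carrier G \<Longrightarrow> set ys \<subseteq> carrier G \<Longrightarrow>
    list_prod G (xs @ ys) = list_prod G xs \<otimes> list_prod G ys"
  by (induction xs) (auto simp: list_prod_closed m_assoc)

text \<open>Since the generators have finite order, their inverses are powers, so that closure under right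
  multiplication by the generators alone is enough. The exponent \<open>Suc e\<close> is positive, and the
  inverse of a generator is its power with exponent \<open>e\<close>.\<close>

lemma (in group) generate_subset_if_right_closed:
  assumes S: "S \<subseteq> carrier G" and e: "\<And>s. s \<in> S \<Longrightarrow> s [^] Suc e = \<one>"
    and X: "X \<subseteq> carrier G" "\<one> \<in> X" and step: "\<And>x s. x \<in> X \<Longrightarrow> s \<in> S \<Longrightarrow> x \<otimes> s \<in> X"
  shows "generate G S \<subseteq> X"
proof -
  have pow: "x \<otimes> s [^] m \<in> X" if "x \<in> X" "s \<in> S" for x s and m :: nat
  proof (induction m)
    case (Suc m)
    have "x \<in> carrier G" "s \<in> carrier G" using that S X by auto
    then show ?case using step[OF Suc that(2)]
      by (simp add: m_assoc)
  qed (use that X in auto)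
  have "\<forall>x\<in>X. x \<otimes> g \<in> X" if "g \<in> generate G S" for g
    using that
  proof (induction g rule: generate.induct)
    case (inv s)
    then have "s \<in> carrier G" "s [^] e \<otimes> s = \<one>" using S e[of s] by auto
    then have "inv s = s [^] e" by (simp add: inv_equality)
    with pow inv show ?case by auto
  next
    case (eng g h)
    then have "g \<in> carrier G" "h \<in> carrier G" using generate_in_carrier[OF S] by auto
    with eng X show ?case by (auto simp: m_assoc[symmetric])
  qed (use X step in auto)
  with X(2) show ?thesis
    using generate_in_carrier[OF S] by force
qed

text \<open>The equation \<open>t x = x' t\<close> expresses that conjugation by \<open>t\<close> takes \<open>x\<close> to \<open>x'\<close>.\<close>

lemma (in group) intertwine_mult:
  assumes "t \<otimes> x = x' \<otimes> t" "t \<otimes> y = y' \<otimes> t"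
    "t \<in> carrier G" "x \<in> carrier G" "x' \<in> carrier G" "y \<in> carrier G" "y' \<in> carrier G"
  shows "t \<otimes> (x \<otimes> y) = (x' \<otimes> y') \<otimes> t"
proof -
  have "t \<otimes> (x \<otimes> y) = (t \<otimes> x) \<otimes> y" using assms(3-7) by (simp only: m_assoc)
  also have "\<dots> = x' \<otimes> (t \<otimes> y)" using assms by (simp only: m_assoc)
  also have "\<dots> = (x' \<otimes> y') \<otimes> t" using assms by (simp only: m_assoc[symmetric])
  finally show ?thesis .
qed

lemma (in group) intertwine_square_relation:
  assumes t: "t \<otimes> x = x' \<otimes> t" "t \<otimes> y = y' \<otimes> t"
    and c: "t \<in> carrier G" "x \<in> carrier G" "x' \<in> carrier G" "y \<in> carrier G" "y' \<in> carrier G"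
    and r: "x \<otimes> x = y \<otimes> (x \<otimes> x) \<otimes> y"
  shows "x' \<otimes> x' = y' \<otimes> (x' \<otimes> x') \<otimes> y'"
proof -
  have xx: "t \<otimes> (x \<otimes> x) = (x' \<otimes> x') \<otimes> t" by (intro intertwine_mult t c)
  have "t \<otimes> (y \<otimes> (x \<otimes> x) \<otimes> y) = (y' \<otimes> (x' \<otimes> x') \<otimes> y') \<otimes> t"
    by (intro intertwine_mult xx t c m_closed)
  then show ?thesis using xx c r by (metis m_closed right_cancel)
qed

section \<open>Consequences of the relations\<close>

locale braid_square_group = group G for G (structure) +
  fixes R :: "nat \<Rightarrow> 'a" and N :: nat
  assumes two_le: "2 \<le> N"
    and R_closed: "\<And>i. 1 \<le> i \<Longrightarrow> i \<le> N \<Longrightarrow> R i \<in> carrier G"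
    and braid: "\<And>i. 1 \<le> i \<Longrightarrow> Suc i \<le> N \<Longrightarrow> R i \<otimes> R (Suc i) \<otimes> R i = R (Suc i) \<otimes> R i \<otimes> R (Suc i)"
    and far: "\<And>i j. 1 \<le> i \<Longrightarrow> j \<le> N \<Longrightarrow> i + 2 \<le> j \<Longrightarrow> R i \<otimes> R j = R j \<otimes> R i"
    and base: "R 1 \<otimes> R 1 = R 2 \<otimes> (R 1 \<otimes> R 1) \<otimes> R 2"
begin

text \<open>Conjugation by \<open>R\<^sub>i R\<^sub>i\<^sub>+\<^sub>1 R\<^sub>i\<^sub>+\<^sub>2\<close> takes the pair \<open>R\<^sub>i, R\<^sub>i\<^sub>+\<^sub>1\<close> to the pair \<open>R\<^sub>i\<^sub>+\<^sub>1, R\<^sub>i\<^sub>+\<^sub>2\<close> and so shifts the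
  relation between the first two generators along the whole chain.\<close>

lemma square_relation_up:
  "1 \<le> i \<Longrightarrow> Suc i \<le> N \<Longrightarrow> R i \<otimes> R i = R (Suc i) \<otimes> (R i \<otimes> R i) \<otimes> R (Suc i)"
proof (induction i rule: dec_induct)
  case base
  then show ?case using braid_square_group.base[OF braid_square_group_axioms] by (simp add: numeral_2_eq_2)
next
  case (step i)
  let ?a = "R i" and ?b = "R (Suc i)" and ?c = "R (Suc (Suc i))"
  have cl: "?a \<in> carrier G" "?b \<in> carrier G" "?c \<in> carrier G" using step R_closed by auto
  have ab: "?a \<otimes> ?b \<otimes> ?a = ?b \<otimes> ?a \<otimes> ?b" and bc: "?b \<otimes> ?c \<otimes> ?b = ?c \<otimes> ?b \<otimes> ?c"
    and ac: "?a \<otimes> ?c = ?c \<otimes> ?a"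
    using step by (auto intro: braid far)
  have 1: "(?a \<otimes> ?b \<otimes> ?c) \<otimes> ?a = ?b \<otimes> (?a \<otimes> ?b \<otimes> ?c)"
  proof -
    have "(?a \<otimes> ?b \<otimes> ?c) \<otimes> ?a = ?a \<otimes> ?b \<otimes> (?a \<otimes> ?c)"
      using cl by (simp add: m_assoc ac)
    also have "\<dots> = (?a \<otimes> ?b \<otimes> ?a) \<otimes> ?c" using cl by (simp add: m_assoc)
    also have "\<dots> = ?b \<otimes> (?a \<otimes> ?b \<otimes> ?c)" unfolding ab using cl by (simp add: m_assoc)
    finally show ?thesis .
  qed
  have 2: "(?a \<otimes> ?b \<otimes> ?c) \<otimes> ?b = ?c \<otimes> (?a \<otimes> ?b \<otimes> ?c)"
  proof -
    have "(?a \<otimes> ?b \<otimes> ?c) \<otimes> ?b = ?a \<otimes> (?b \<otimes> ?c \<otimes> ?b)" using cl by (simp add: m_assoc)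
    also have "\<dots> = (?a \<otimes> ?c) \<otimes> (?b \<otimes> ?c)" unfolding bc using cl by (simp add: m_assoc)
    also have "\<dots> = ?c \<otimes> (?a \<otimes> ?b \<otimes> ?c)" unfolding ac using cl by (simp add: m_assoc)
    finally show ?thesis .
  qed
  show ?case
    by (rule intertwine_square_relation[OF 1 2]) (use cl step in auto)
qed

text \<open>Conjugation by \<open>R\<^sub>i R\<^sub>i\<^sub>+\<^sub>1 R\<^sub>i\<close> exchanges \<open>R\<^sub>i\<close> and \<open>R\<^sub>i\<^sub>+\<^sub>1\<close>.\<close>

lemma square_relation_down:
  assumes "1 \<le> i" "Suc i \<le> N"
  shows "R (Suc i) \<otimes> R (Suc i) = R i \<otimes> (R (Suc i) \<otimes> R (Suc i)) \<otimes> R i"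
proof -
  let ?a = "R i" and ?b = "R (Suc i)"
  have cl: "?a \<in> carrier G" "?b \<in> carrier G" using assms R_closed by auto
  have ab: "?a \<otimes> ?b \<otimes> ?a = ?b \<otimes> ?a \<otimes> ?b" using assms by (rule braid)
  have 1: "(?a \<otimes> ?b \<otimes> ?a) \<otimes> ?a = ?b \<otimes> (?a \<otimes> ?b \<otimes> ?a)"
  proof -
    have "?b \<otimes> (?a \<otimes> ?b \<otimes> ?a) = (?b \<otimes> ?a \<otimes> ?b) \<otimes> ?a" using cl by (simp add: m_assoc)
    then show ?thesis by (simp only: ab)
  qed
  have 2: "(?a \<otimes> ?b \<otimes> ?a) \<otimes> ?b = ?a \<otimes> (?a \<otimes> ?b \<otimes> ?a)"
  proof -
    have "(?a \<otimes> ?b \<otimes> ?a) \<otimes> ?b = ?a \<otimes> (?b \<otimes> ?a \<otimes> ?b)" using cl by (simp add: m_assoc)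
    then show ?thesis by (simp only: ab)
  qed
  show ?thesis
    by (rule intertwine_square_relation[OF 1 2]) (use cl assms square_relation_up in auto)
qed

end

text \<open>The assumptions say that \<open>A\<close> and \<open>B\<close> invert each other by conjugation, as in the quaternion group.
  Substituting either assumption into the other gives \<open>A\<^sup>2 = B A B A = B\<^sup>2\<close>; substituting both
  gives \<open>B A\<^sup>2 B = 1\<close>.\<close>

lemma (in group) mutual_inversion:
  assumes cl: "A \<in> carrier G" "B \<in> carrier G"
    and A: "A = B \<otimes> A \<otimes> B" and B: "B = A \<otimes> B \<otimes> A"
  shows "A \<otimes> A = B \<otimes> B" "(B \<otimes> B) \<otimes> (B \<otimes> B) = \<one>"
proof -
  have "A \<otimes> A = B \<otimes> A \<otimes> B \<otimes> A" using A by simp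
  also have "\<dots> = B \<otimes> (A \<otimes> B \<otimes> A)" using cl by (simp add: m_assoc)
  finally show eq: "A \<otimes> A = B \<otimes> B" using B by simp
  have "A \<otimes> (B \<otimes> (A \<otimes> A) \<otimes> B) = (A \<otimes> B \<otimes> A) \<otimes> A \<otimes> B" using cl by (simp add: m_assoc)
  also have "\<dots> = A" using A B by simp
  finally have "B \<otimes> (A \<otimes> A) \<otimes> B = \<one>" using cl using cl by simp
  then show "(B \<otimes> B) \<otimes> (B \<otimes> B) = \<one>" using cl by (simp add: eq m_assoc)
qed


lemma (in group) list_prod_commute:
  assumes "x \<in> carrier G" "set ys \<subseteq> carrier G" "\<And>y. y \<in> set ys \<Longrightarrow> x \<otimes> y = y \<otimes> x"
  shows "x \<otimes> list_prod G ys = list_prod G ys \<otimes> x"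
  using assms
proof (induction ys)
  case (Cons y ys)
  then have cl: "y \<in> carrier G" "list_prod G ys \<in> carrier G" by (auto intro: list_prod_closed)
  have "x \<otimes> (y \<otimes> list_prod G ys) = (y \<otimes> x) \<otimes> list_prod G ys"
    using Cons.prems cl by (simp add: m_assoc[symmetric])
  also have "\<dots> = y \<otimes> (x \<otimes> list_prod G ys)" using Cons.prems cl by (simp add: m_assoc)
  also have "\<dots> = y \<otimes> list_prod G ys \<otimes> x" using Cons cl by (simp add: m_assoc)
  finally show ?case by simp
qed simp

context braid_square_group
begin

abbreviation sq :: "nat \<Rightarrow> 'a" where "sq i \<equiv> R i \<otimes> R i"

text \<open>The forms in which the square relation is used: squares of adjacent generators invert each
  other's roots by conjugation.\<close>

lemma square_relations:
  assumes "1 \<le> i" "Suc i \<le> N"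
  shows "inv (R (Suc i)) \<otimes> sq i = sq i \<otimes> R (Suc i)" "sq (Suc i) \<otimes> R i = inv (R i) \<otimes> sq (Suc i)"
    "R (Suc i) \<otimes> sq i = sq (Suc i) \<otimes> sq i \<otimes> R (Suc i)"
proof -
  have cl: "R i \<in> carrier G" "R (Suc i) \<in> carrier G" using assms R_closed by auto
  note up = square_relation_up[OF assms] and down = square_relation_down[OF assms]
  have "inv (R (Suc i)) \<otimes> sq i = inv (R (Suc i)) \<otimes> (R (Suc i) \<otimes> sq i \<otimes> R (Suc i))" using up by simp
  also have "\<dots> = sq i \<otimes> R (Suc i)" using cl by (simp add: m_assoc inv_solve_left')
  finally show "inv (R (Suc i)) \<otimes> sq i = sq i \<otimes> R (Suc i)" .
  have "inv (R i) \<otimes> sq (Suc i) = inv (R i) \<otimes> (R i \<otimes> sq (Suc i) \<otimes> R i)" using down by simp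
  also have "\<dots> = sq (Suc i) \<otimes> R i" using cl by (simp add: m_assoc inv_solve_left')
  finally show "sq (Suc i) \<otimes> R i = inv (R i) \<otimes> sq (Suc i)" by simp
  have "R (Suc i) \<otimes> sq i = R (Suc i) \<otimes> (R (Suc i) \<otimes> sq i \<otimes> R (Suc i))" using up by simp
  also have "\<dots> = sq (Suc i) \<otimes> sq i \<otimes> R (Suc i)" using cl by (simp add: m_assoc)
  finally show "R (Suc i) \<otimes> sq i = sq (Suc i) \<otimes> sq i \<otimes> R (Suc i)" .
qed

lemma fourth_powers:
  assumes "1 \<le> i" "Suc i \<le> N"
  shows "sq i \<otimes> sq i = sq (Suc i) \<otimes> sq (Suc i)"
    "(sq (Suc i) \<otimes> sq (Suc i)) \<otimes> (sq (Suc i) \<otimes> sq (Suc i)) = \<one>"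
proof -
  have cl: "R i \<in> carrier G" "R (Suc i) \<in> carrier G" using assms R_closed by auto
  note up = square_relation_up[OF assms] and down = square_relation_down[OF assms]
  have "R (Suc i) \<otimes> (R (Suc i) \<otimes> sq i \<otimes> R (Suc i)) \<otimes> R (Suc i) = sq (Suc i) \<otimes> sq i \<otimes> sq (Suc i)"
    using cl by (simp add: m_assoc)
  then have A: "sq i = sq (Suc i) \<otimes> sq i \<otimes> sq (Suc i)" by (simp only: up[symmetric])
  have "R i \<otimes> (R i \<otimes> sq (Suc i) \<otimes> R i) \<otimes> R i = sq i \<otimes> sq (Suc i) \<otimes> sq i"
    using cl by (simp add: m_assoc)
  then have B: "sq (Suc i) = sq i \<otimes> sq (Suc i) \<otimes> sq i" by (simp only: down[symmetric])
  show "sq i \<otimes> sq i = sq (Suc i) \<otimes> sq (Suc i)"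
    "(sq (Suc i) \<otimes> sq (Suc i)) \<otimes> (sq (Suc i) \<otimes> sq (Suc i)) = \<one>"
    using mutual_inversion[OF _ _ A B] cl by auto
qed

lemma fourth_power_eq:
  "1 \<le> i \<Longrightarrow> i \<le> N \<Longrightarrow> sq i \<otimes> sq i = sq 1 \<otimes> sq 1"
proof (induction i rule: dec_induct)
  case (step i)
  then show ?case using fourth_powers(1)[of i] by simp
qed simp

lemma eighth_power:
  assumes "1 \<le> i" "i \<le> N"
  shows "R i [^] Suc 7 = \<one>"
proof -
  have cl: "R i \<in> carrier G" using assms R_closed by auto
  have "(sq 2 \<otimes> sq 2) \<otimes> (sq 2 \<otimes> sq 2) = \<one>"
    using fourth_powers(2)[of 1] two_le by (simp add: numeral_2_eq_2)
  then have "(sq i \<otimes> sq i) \<otimes> (sq i \<otimes> sq i) = \<one>"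
    using fourth_power_eq[of 2] fourth_power_eq[of i] assms two_le by simp
  moreover have "R i [^] Suc 7 = (sq i \<otimes> sq i) \<otimes> (sq i \<otimes> sq i)"
    using cl by (simp add: eval_nat_numeral m_assoc)
  ultimately show ?thesis by simp
qed

section \<open>Coset representatives\<close>

definition parabolic :: "nat \<Rightarrow> 'a set" where "parabolic k = generate G (R ` {1..k})"
text \<open>In the model this is the stabiliser of the line through \<open>e\<^sub>k\<^sub>+\<^sub>1\<close>, in which \<open>R\<^sub>k\<^sup>2\<close> reverses the
  direction of that line. Working with its cosets instead of those of \<open>parabolic (k - 1)\<close> removes all
  signs from the coset enumeration; they are restored by \<open>extended_subset_parabolic_square\<close>.\<close>

definition extended_parabolic :: "nat \<Rightarrow> 'a set" where "extended_parabolic k = generate G (insert (sq k) (R ` {1..<k}))"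
text \<open>The element \<open>R\<^sub>k R\<^sub>k\<^sub>-\<^sub>1 \<dots> R\<^sub>p\<close>, which in the model sends \<open>e\<^sub>p\<close> to \<open>e\<^sub>k\<^sub>+\<^sub>1\<close>; it is \<open>1\<close> for \<open>p = k + 1\<close>.\<close>

definition descent :: "nat \<Rightarrow> nat \<Rightarrow> 'a" where "descent k p = list_prod G (map R (rev [p..<Suc k]))"

lemma R_image_closed: "k \<le> N \<Longrightarrow> R ` {1..k} \<subseteq> carrier G"
  using R_closed by auto

lemma subgroup_parabolic: "k \<le> N \<Longrightarrow> subgroup (parabolic k) G"
  unfolding parabolic_def by (rule generate_is_subgroup[OF R_image_closed])

lemma subgroup_extended:
  assumes "1 \<le> k" "k \<le> N"
  shows "subgroup (extended_parabolic k) G"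
  unfolding extended_parabolic_def by (rule generate_is_subgroup) (use assms R_closed in auto)

lemma R_in_parabolic: "1 \<le> i \<Longrightarrow> i \<le> k \<Longrightarrow> R i \<in> parabolic k"
  unfolding parabolic_def by (rule generate.incl) auto

lemma R_in_extended: "1 \<le> i \<Longrightarrow> i < k \<Longrightarrow> R i \<in> extended_parabolic k"
  unfolding extended_parabolic_def by (rule generate.incl) auto

lemma square_in_extended: "sq k \<in> extended_parabolic k"
  unfolding extended_parabolic_def by (rule generate.incl) auto

lemma descent_closed: "1 \<le> p \<Longrightarrow> k \<le> N \<Longrightarrow> descent k p \<in> carrier G"
  unfolding descent_def using R_closed by (intro list_prod_closed) auto

lemma descent_top: "descent k (Suc k) = \<one>"
  by (simp add: descent_def)

lemma descent_step:
  assumes "1 \<le> p" "p \<le> k" "k \<le> N"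
  shows "descent k p = descent k (Suc p) \<otimes> R p"
proof -
  have "rev [p..<Suc k] = rev [Suc p..<Suc k] @ [p]"
    using assms by (simp add: upt_conv_Cons del: upt_Suc)
  then have "descent k p = list_prod G (map R (rev [Suc p..<Suc k]) @ [R p])"
    unfolding descent_def by (simp only: map_append list.map)
  also have "\<dots> = list_prod G (map R (rev [Suc p..<Suc k])) \<otimes> list_prod G [R p]"
    by (rule list_prod_append) (use assms R_closed in auto)
  finally show ?thesis using assms R_closed by (simp add: descent_def)
qed

lemma descent_far:
  assumes "1 \<le> j" "j + 2 \<le> p" "k \<le> N" "j \<le> N"
  shows "R j \<otimes> descent k p = descent k p \<otimes> R j"
  unfolding descent_def
proof (rule list_prod_commute)
  show "R j \<otimes> y = y \<otimes> R j" if "y \<in> set (map R (rev [p..<Suc k]))" for y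
    using that assms far[of j] by (auto simp del: upt_Suc)
qed (use assms R_closed in auto)

text \<open>A generator \<open>R\<^sub>i\<^sub>+\<^sub>1\<close> that occurs inside the descending word passes to the left through the word up
  to \<open>R\<^sub>i\<^sub>+\<^sub>1 R\<^sub>i\<close>; there the braid relation lowers its index, and \<open>R\<^sub>i\<close> commutes with the
  remaining letters, whose indices exceed \<open>i + 1\<close>.\<close>

lemma descent_shift:
  assumes "1 \<le> p" "p \<le> i" "Suc i \<le> k" "k \<le> N"
  shows "descent k p \<otimes> R (Suc i) = R i \<otimes> descent k p"
  using assms(2,1)
proof (induction p rule: inc_induct)
  case base
  let ?d = "descent k (Suc (Suc i))"
  have cl: "R i \<in> carrier G" "R (Suc i) \<in> carrier G" "?d \<in> carrier G"
    using assms base R_closed descent_closed by auto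
  have c: "descent k i = ?d \<otimes> R (Suc i) \<otimes> R i" using assms base by (simp add: descent_step)
  have "descent k i \<otimes> R (Suc i) = ?d \<otimes> (R (Suc i) \<otimes> R i \<otimes> R (Suc i))" using cl by (simp add: c m_assoc)
  also have "\<dots> = ?d \<otimes> (R i \<otimes> R (Suc i) \<otimes> R i)" using braid[of i] assms base by simp
  also have "\<dots> = ?d \<otimes> R i \<otimes> (R (Suc i) \<otimes> R i)" using cl by (simp add: m_assoc)
  also have "?d \<otimes> R i = R i \<otimes> ?d" using descent_far[of i "Suc (Suc i)" k] assms base by simp
  finally show ?case using cl by (simp add: c m_assoc)
next
  case (step p)
  have cl: "R i \<in> carrier G" "R (Suc i) \<in> carrier G" "R p \<in> carrier G" "descent k (Suc p) \<in> carrier G"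
    using assms step R_closed descent_closed by auto
  have c: "descent k p = descent k (Suc p) \<otimes> R p" using assms step by (simp add: descent_step)
  have "descent k p \<otimes> R (Suc i) = descent k (Suc p) \<otimes> (R p \<otimes> R (Suc i))" using cl by (simp add: c m_assoc)
  also have "R p \<otimes> R (Suc i) = R (Suc i) \<otimes> R p" using step assms by (intro far) auto
  also have "descent k (Suc p) \<otimes> (R (Suc i) \<otimes> R p) = (descent k (Suc p) \<otimes> R (Suc i)) \<otimes> R p" using cl by (simp add: m_assoc)
  also have "descent k (Suc p) \<otimes> R (Suc i) = R i \<otimes> descent k (Suc p)" using step by simp
  finally show ?case using cl by (simp add: c m_assoc)
qed

text \<open>In the model, \<open>R\<^sub>p\<^sup>2\<close> reverses \<open>e\<^sub>p\<^sub>+\<^sub>1\<close>, which \<open>R\<^sub>k \<dots> R\<^sub>p\<^sub>+\<^sub>1\<close> sends to \<open>e\<^sub>k\<^sub>+\<^sub>1\<close>. The rule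
  \<open>R\<^sub>p\<^sub>+\<^sub>1 R\<^sub>p\<^sup>2 = R\<^sub>p\<^sub>+\<^sub>1\<^sup>2 R\<^sub>p\<^sup>2 R\<^sub>p\<^sub>+\<^sub>1\<close> moves a square to the left while raising its index, until it becomes the
  square of \<open>R\<^sub>k\<close> in front of the word; the squares left behind have index below \<open>k\<close> and commute
  with the letters to their left.\<close>

lemma descent_square:
  assumes "1 \<le> p" "p \<le> k" "k \<le> N"
  shows "\<exists>m\<in>extended_parabolic k. descent k (Suc p) \<otimes> sq p = m \<otimes> descent k (Suc p)"
  using assms(2,1)
proof (induction p rule: inc_induct)
  case base
  then show ?case using R_closed assms square_in_extended[of k] by (intro bexI[of _ "sq k"]) (auto simp: descent_top)
next
  case (step p)
  let ?d = "descent k (Suc (Suc p))"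
  from step obtain m where m: "m \<in> extended_parabolic k" "?d \<otimes> sq (Suc p) = m \<otimes> ?d" by auto
  have sub: "subgroup (extended_parabolic k) G" using assms by (intro subgroup_extended) auto
  have cl: "R p \<in> carrier G" "R (Suc p) \<in> carrier G" "?d \<in> carrier G" "m \<in> carrier G"
    using assms step R_closed descent_closed m subgroup.mem_carrier[OF sub] by auto
  have c: "descent k (Suc p) = ?d \<otimes> R (Suc p)" using assms step by (simp add: descent_step)
  have dp: "?d \<otimes> sq p = sq p \<otimes> ?d"
    using descent_far[of p "Suc (Suc p)" k] assms step.hyps step.prems cl by (intro intertwine_mult) auto
  have "descent k (Suc p) \<otimes> sq p = ?d \<otimes> (R (Suc p) \<otimes> sq p)" using cl by (simp add: c m_assoc)
  also have "R (Suc p) \<otimes> sq p = sq (Suc p) \<otimes> sq p \<otimes> R (Suc p)"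
    by (rule square_relations) (use assms step in auto)
  also have "?d \<otimes> (sq (Suc p) \<otimes> sq p \<otimes> R (Suc p)) = (?d \<otimes> sq (Suc p)) \<otimes> (sq p \<otimes> R (Suc p))"
    using cl by (simp add: m_assoc)
  also have "\<dots> = m \<otimes> (?d \<otimes> sq p) \<otimes> R (Suc p)" unfolding m(2) using cl by (simp add: m_assoc)
  also have "\<dots> = (m \<otimes> sq p) \<otimes> descent k (Suc p)" unfolding dp c using cl by (simp add: m_assoc)
  finally show ?case
    using m(1) R_in_extended[of p k] step sub
    by (intro bexI[of _ "m \<otimes> sq p"]) (auto intro!: subgroup.m_closed)
qed

text \<open>The generator \<open>R\<^sub>j\<close> moves \<open>e\<^sub>p\<close> only for \<open>p = j\<close> and \<open>p = j + 1\<close>, and up to sign it exchanges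
  \<open>e\<^sub>j\<close> and \<open>e\<^sub>j\<^sub>+\<^sub>1\<close>; the coset of the descending word moves accordingly.\<close>

lemma descent_times_generator:
  assumes "1 \<le> p" "p \<le> Suc k" "1 \<le> j" "j \<le> k" "k \<le> N"
  shows "\<exists>q\<in>{1..Suc k}. \<exists>m\<in>extended_parabolic k. descent k p \<otimes> R j = m \<otimes> descent k q"
proof -
  consider "j + 2 \<le> p" | "p = Suc j" | "p = j" | "p < j" by linarith
  then show ?thesis
  proof cases
    case 1
    then show ?thesis using assms descent_far[of j p k] R_in_extended[of j k]
      by (intro bexI[of _ p] bexI[of _ "R j"]) auto
  next
    case 2
    then show ?thesis using assms descent_step[of j k] descent_closed[of j k] subgroup.one_closed[OF subgroup_extended[of k]]
      by (intro bexI[of _ j] bexI[of _ "\<one>"]) auto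
  next
    case 3
    then have "descent k p \<otimes> R j = descent k (Suc p) \<otimes> sq p"
      using assms descent_step[of p k] descent_closed[of "Suc p" k] R_closed by (simp add: m_assoc)
    with 3 show ?thesis using descent_square[of p k] assms by (intro bexI[of _ "Suc p"]) auto
  next
    case 4
    then obtain i where i: "j = Suc i" by (cases j) auto
    with 4 show ?thesis using assms descent_shift[of p i k] R_in_extended[of i k]
      by (intro bexI[of _ p] bexI[of _ "R i"]) auto
  qed
qed

lemma parabolic_subset_extended_descent:
  assumes "1 \<le> k" "k \<le> N"
  shows "parabolic k \<subseteq> {m \<otimes> descent k q | m q. m \<in> extended_parabolic k \<and> q \<in> {1..Suc k}}" (is "_ \<subseteq> ?X")
  unfolding parabolic_def
proof (rule generate_subset_if_right_closed)
  have sub: "subgroup (extended_parabolic k) G" using assms by (rule subgroup_extended)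
  show "R ` {1..k} \<subseteq> carrier G" by (rule R_image_closed) fact
  show "s [^] Suc 7 = \<one>" if "s \<in> R ` {1..k}" for s using that eighth_power assms by auto
  show "?X \<subseteq> carrier G" using assms descent_closed subgroup.mem_carrier[OF sub] by auto
  have "\<one> = \<one> \<otimes> descent k (Suc k)" by (simp add: descent_top)
  then show "\<one> \<in> ?X" using assms subgroup.one_closed[OF sub] by fastforce
  show "x \<otimes> s \<in> ?X" if "x \<in> ?X" "s \<in> R ` {1..k}" for x s
  proof -
    from that obtain m p j where x: "x = m \<otimes> descent k p" "s = R j" "m \<in> extended_parabolic k" "p \<in> {1..Suc k}" "j \<in> {1..k}"
      by blast
    then obtain q m' where q: "q \<in> {1..Suc k}" "m' \<in> extended_parabolic k" "descent k p \<otimes> R j = m' \<otimes> descent k q"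
      using descent_times_generator[of p k j] assms by auto
    have cl: "m \<in> carrier G" "m' \<in> carrier G" "descent k p \<in> carrier G" "descent k q \<in> carrier G" "R j \<in> carrier G"
      using x q assms R_closed descent_closed subgroup.mem_carrier[OF sub] by auto
    have "x \<otimes> s = m \<otimes> (descent k p \<otimes> R j)" using cl x by (simp add: m_assoc)
    also have "\<dots> = (m \<otimes> m') \<otimes> descent k q" unfolding q(3) using cl by (simp add: m_assoc)
    finally show ?thesis using x q subgroup.m_closed[OF sub] by blast
  qed
qed

text \<open>The square of \<open>R\<^sub>k\<close> normalises \<open>parabolic (k - 1)\<close>, as it inverts \<open>R\<^sub>k\<^sub>-\<^sub>1\<close> and commutes with the other
  generators. Its own square is \<open>R\<^sub>k\<^sup>4 = R\<^sub>1\<^sup>4\<close>, which lies in \<open>parabolic (k - 1)\<close> for \<open>k \<ge> 2\<close>.\<close>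

lemma extended_subset_parabolic_square:
  assumes "2 \<le> k" "k \<le> N"
  shows "extended_parabolic k \<subseteq> {h \<otimes> w | h w. h \<in> parabolic (k - 1) \<and> w \<in> {\<one>, sq k}}" (is "_ \<subseteq> ?X")
  unfolding extended_parabolic_def
proof (rule generate_subset_if_right_closed)
  have sub: "subgroup (parabolic (k - 1)) G" using assms by (intro subgroup_parabolic) auto
  have Rk: "R k \<in> carrier G" using assms R_closed by auto
  show "insert (sq k) (R ` {1..<k}) \<subseteq> carrier G" using Rk assms R_closed by auto
  show "s [^] Suc 7 = \<one>" if "s \<in> insert (sq k) (R ` {1..<k})" for s
  proof -
    have "sq k [^] Suc 7 = R k [^] Suc 7 \<otimes> R k [^] Suc 7" using Rk by (simp add: pow_mult_distrib)
    then show ?thesis using that eighth_power[of k] eighth_power assms by auto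
  qed
  show "?X \<subseteq> carrier G" using Rk subgroup.mem_carrier[OF sub] by auto
  have "\<one> = \<one> \<otimes> \<one>" by simp
  then show "\<one> \<in> ?X" using subgroup.one_closed[OF sub] by blast
  show "x \<otimes> s \<in> ?X" if x: "x \<in> ?X" and s: "s \<in> insert (sq k) (R ` {1..<k})" for x s
  proof -
    from x obtain h w where h: "h \<in> parabolic (k - 1)" "w \<in> {\<one>, sq k}" "x = h \<otimes> w" by blast
    have hc: "h \<in> carrier G" using h subgroup.mem_carrier[OF sub] by auto
    have "\<exists>h'\<in>parabolic (k - 1). \<exists>w'\<in>{\<one>, sq k}. w \<otimes> s = h' \<otimes> w'"
    proof (cases "s = sq k")
      case True
      have "sq 1 \<otimes> sq 1 \<in> parabolic (k - 1)"
        using R_in_parabolic[of 1 "k - 1"] assms by (intro subgroup.m_closed[OF sub]) auto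
      then have "sq k \<otimes> sq k \<in> parabolic (k - 1)" using fourth_power_eq[of k] assms by simp
      moreover have "sq k \<otimes> sq k = sq k \<otimes> sq k \<otimes> \<one>" "\<one> \<otimes> sq k = \<one> \<otimes> sq k" using Rk by auto
      ultimately show ?thesis using True h(2) subgroup.one_closed[OF sub] by blast
    next
      case False
      then obtain j where j: "1 \<le> j" "j < k" "s = R j" using s by auto
      have Rj: "R j \<in> carrier G" "R j \<in> parabolic (k - 1)" using j assms R_closed R_in_parabolic[of j "k - 1"] by auto
      have "\<exists>h'\<in>parabolic (k - 1). sq k \<otimes> R j = h' \<otimes> sq k"
      proof (cases "Suc j = k")
        case True
        then show ?thesis
          using square_relations(2)[of j] j assms Rj subgroup.m_inv_closed[OF sub] by auto
      next
        case False
        then have "R j \<otimes> R k = R k \<otimes> R j" using j assms by (intro far) auto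
        then have "R j \<otimes> sq k = sq k \<otimes> R j" using Rj Rk by (intro intertwine_mult) auto
        then show ?thesis using Rj by (intro bexI[of _ "R j"]) simp_all
      qed
      moreover have "\<one> \<otimes> R j = R j \<otimes> \<one>" using Rj by simp
      ultimately show ?thesis using h(2) j(3) Rj(2) by blast
    qed
    then obtain h' w' where h': "h' \<in> parabolic (k - 1)" "w' \<in> {\<one>, sq k}" "w \<otimes> s = h' \<otimes> w'" by blast
    have cl: "h' \<in> carrier G" "w \<in> carrier G" "w' \<in> carrier G" "s \<in> carrier G"
      using h h' s Rk R_closed assms subgroup.mem_carrier[OF sub] by auto
    have "x \<otimes> s = h \<otimes> (w \<otimes> s)" using h cl hc by (simp add: m_assoc)
    also have "\<dots> = (h \<otimes> h') \<otimes> w'" unfolding h'(3) using cl hc by (simp add: m_assoc)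
    finally show ?thesis using h h' subgroup.m_closed[OF sub] by blast
  qed
qed

lemma parabolic_decomposition:
  assumes "2 \<le> k" "k \<le> N" "x \<in> parabolic k"
  shows "\<exists>h\<in>parabolic (k - 1). \<exists>w\<in>factor_expressions k. x = h \<otimes> list_prod G (map R w)"
proof -
  have sub: "subgroup (parabolic (k - 1)) G" using assms by (intro subgroup_parabolic) auto
  obtain m q where m: "x = m \<otimes> descent k q" "m \<in> extended_parabolic k" "q \<in> {1..Suc k}"
    using assms parabolic_subset_extended_descent[of k] by auto
  obtain h w where h: "m = h \<otimes> w" "h \<in> parabolic (k - 1)" "w \<in> {\<one>, sq k}"
    using m assms extended_subset_parabolic_square[of k] by blast
  have cl: "h \<in> carrier G" "R k \<in> carrier G" "descent k q \<in> carrier G"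
    using h m assms subgroup.mem_carrier[OF sub] R_closed descent_closed by auto
  show ?thesis
  proof (cases "w = \<one>")
    case True
    then have "x = h \<otimes> list_prod G (map R (rev [q..<Suc k]))"
      using cl m h by (simp add: descent_def del: upt_Suc)
    moreover have "rev [q..<Suc k] \<in> factor_expressions k"
      using m(3) assms by (subst factor_expressions_eq) auto
    ultimately show ?thesis using h by blast
  next
    case False
    then have "x = h \<otimes> list_prod G (map R (k # k # rev [q..<Suc k]))"
      using cl m h by (simp add: descent_def m_assoc del: upt_Suc)
    moreover have "k # k # rev [q..<Suc k] \<in> factor_expressions k"
      using m(3) assms by (subst factor_expressions_eq) auto
    ultimately show ?thesis using h by blast
  qed
qed

lemma list_prod_map_append:
  assumes "set u \<subseteq> {1..N}" "set v \<subseteq> {1..N}"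
  shows "list_prod G (map R (u @ v)) = list_prod G (map R u) \<otimes> list_prod G (map R v)"
  unfolding map_append by (rule list_prod_append) (use assms R_closed in auto)

lemma parabolic_1_subset: "parabolic 1 \<subseteq> {list_prod G (map R (replicate m 1)) | m. m \<le> 7}" (is "_ \<subseteq> ?X")
  unfolding parabolic_def
proof (rule generate_subset_if_right_closed)
  have R1: "R 1 \<in> carrier G" and e: "R 1 [^] Suc 7 = \<one>"
    using R_closed eighth_power[of 1] two_le by auto
  have pow: "list_prod G (map R (replicate m 1)) = R 1 [^] m" for m
  proof (induction m)
    case (Suc m)
    then show ?case using R1 nat_pow_Suc2[of "R 1" m] by simp
  qed simp
  have X: "?X = {R 1 [^] m | m. m \<le> (7::nat)}" unfolding pow ..
  show "R ` {1..1} \<subseteq> carrier G" using R1 by simp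
  show "?X \<subseteq> carrier G" unfolding X using R1 by auto
  have "\<one> = R 1 [^] (0::nat)" by simp
  then show one: "\<one> \<in> ?X" unfolding X by blast
  show "s [^] Suc 7 = \<one>" if "s \<in> R ` {1..1}" for s using that e by simp
  fix x s assume "x \<in> ?X" "s \<in> R ` {1..1}"
  then obtain m :: nat where m: "m \<le> 7" "x = R 1 [^] m" "s = R 1" unfolding X by auto
  then have "x \<otimes> s = R 1 [^] Suc m" by simp
  moreover have "R 1 [^] Suc m \<in> ?X"
  proof (cases "m = 7")
    case True
    then show ?thesis using one by (simp only: e)
  next
    case False
    then have "Suc m \<le> 7" using m by simp
    then show ?thesis unfolding X by blast
  qed
  ultimately show "x \<otimes> s \<in> ?X" by simp
qed

lemma canonical_form_exists:
  assumes "1 \<le> k" "k \<le> N" "x \<in> parabolic k"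
  shows "\<exists>m\<le>7. \<exists>y\<in>\<Pi>\<^sub>E i\<in>{2..k}. factor_expressions i. x = list_prod G (map R (canonical_word k m y))"
  using assms
proof (induction k arbitrary: x rule: dec_induct)
  case base
  then obtain m where "m \<le> 7" "x = list_prod G (map R (replicate m 1))" using parabolic_1_subset by auto
  \<comment> \<open>For \<open>k = 1\<close> there are no factors, and the extensional product over the empty set contains only
    the function that is undefined everywhere.\<close>
  then show ?case
    by (intro exI[of _ m] conjI bexI[of _ "\<lambda>_. undefined"]) (auto simp: canonical_word_def)
next
  case (step k)
  obtain h w where h: "h \<in> parabolic k" "w \<in> factor_expressions (Suc k)" "x = h \<otimes> list_prod G (map R w)"
    using parabolic_decomposition[of "Suc k" x] step by auto
  obtain m y where y: "m \<le> 7" "y \<in> (\<Pi>\<^sub>E i\<in>{2..k}. factor_expressions i)"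
      "h = list_prod G (map R (canonical_word k m y))"
    using step.IH[OF _ h(1)] step.prems(1) by (metis Suc_leD)
  let ?y = "y(Suc k := w)"
  have "{2..Suc k} = insert (Suc k) {2..k}" using step by auto
  then have y': "?y \<in> (\<Pi>\<^sub>E i\<in>{2..Suc k}. factor_expressions i)"
    using PiE_fun_upd[OF h(2) y(2)] by simp
  have "canonical_word (Suc k) m ?y = canonical_word k m ?y @ w"
    using canonical_word_Suc[of k m ?y] step by simp
  moreover have "canonical_word k m ?y = canonical_word k m y"
    unfolding canonical_word_def by (intro arg_cong2[of _ _ _ _ "(@)"] refl arg_cong[of _ _ concat] map_cong) auto
  ultimately have "canonical_word (Suc k) m ?y = canonical_word k m y @ w" by simp
  moreover have "set (canonical_word k m y) \<subseteq> {1..k}"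
    by (rule set_canonical_word) (use step.hyps y(2) in \<open>auto dest: PiE_mem\<close>)
  moreover have "set w \<subseteq> {1..Suc k}" using factor_expressions_subset[OF _ h(2)] by simp
  ultimately have "x = list_prod G (map R (canonical_word (Suc k) m ?y))"
    using list_prod_map_append[of "canonical_word k m y" w] step.prems(1) h(3) y(3) by fastforce
  then show ?case using y(1) y' by blast
qed

end

section \<open>The presented group and its actions\<close>

lemma pos_word_in_words_over: "set w \<subseteq> S \<Longrightarrow> pos_word w \<in> words_over S"
  by (induction w) (auto simp: pos_word_def)

lemma expression_value_class:
  "set w \<subseteq> {1..n - 1} \<Longrightarrow>
    expression_value n w = pres_rel {1..n - 1} (G_relations n) `` {pos_word w}"
proof (induction w)
  case Nil
  then show ?case by (simp add: expression_value_def G_group_def pres_one pos_word_def)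
next
  case (Cons i w)
  have "pos_word w \<in> words_over {1..n - 1}" using Cons.prems by (intro pos_word_in_words_over) simp
  then show ?case using Cons
    by (auto simp: expression_value_def G_group_def G_gen_def pres_gen_def pres_mult pos_word_def)
qed

lemma expression_value_relation:
  assumes "(pos_word u, pos_word v) \<in> G_relations n" "set u \<subseteq> {1..n - 1}" "set v \<subseteq> {1..n - 1}"
  shows "expression_value n u = expression_value n v"
  using assms by (simp add: expression_value_class pos_word_in_words_over pres_class_eq_iff pres_cong.rel)

lemma group_G_group: "group (G_group n)"
  unfolding G_group_def by (rule group_presented_group)

lemma G_gen_closed: "i \<in> {1..n - 1} \<Longrightarrow> G_gen n i \<in> carrier (G_group n)"
  unfolding G_group_def G_gen_def by (rule pres_gen_closed)

lemma braid_square_group_G_group: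
  assumes "n \<ge> 3"
  shows "braid_square_group (G_group n) (G_gen n) (n - 1)"
proof -
  interpret group "G_group n" by (rule group_G_group)
  note [simp] = G_gen_closed[simplified]
  show ?thesis
  proof
    show "2 \<le> n - 1" using assms by simp
    show "G_gen n i \<in> carrier (G_group n)" if "1 \<le> i" "i \<le> n - 1" for i
      using that by (intro G_gen_closed) simp
    show "G_gen n i \<otimes>\<^bsub>G_group n\<^esub> G_gen n (Suc i) \<otimes>\<^bsub>G_group n\<^esub> G_gen n i
        = G_gen n (Suc i) \<otimes>\<^bsub>G_group n\<^esub> G_gen n i \<otimes>\<^bsub>G_group n\<^esub> G_gen n (Suc i)"
      if "1 \<le> i" "Suc i \<le> n - 1" for i
    proof -
      have "(pos_word [i, Suc i, i], pos_word [Suc i, i, Suc i]) \<in> G_relations n"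
        unfolding G_relations_def using that by auto
      from expression_value_relation[OF this] that show ?thesis
        by (simp add: expression_value_def m_assoc)
    qed
    show "G_gen n i \<otimes>\<^bsub>G_group n\<^esub> G_gen n j = G_gen n j \<otimes>\<^bsub>G_group n\<^esub> G_gen n i"
      if "1 \<le> i" "j \<le> n - 1" "i + 2 \<le> j" for i j
    proof -
      have "(pos_word [i, j], pos_word [j, i]) \<in> G_relations n"
        unfolding G_relations_def using that
        by (intro UnI1[OF UnI2] CollectI exI[of _ i] exI[of _ j]) auto
      from expression_value_relation[OF this] that show ?thesis
        by (simp add: expression_value_def)
    qed
    have "(pos_word [1, 1], pos_word [2, 1, 1, 2]) \<in> G_relations n"
      unfolding G_relations_def by auto
    from expression_value_relation[OF this] assms
    have "G_gen n 1 \<otimes>\<^bsub>G_group n\<^esub> G_gen n 1 =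
        G_gen n 2 \<otimes>\<^bsub>G_group n\<^esub> (G_gen n 1 \<otimes>\<^bsub>G_group n\<^esub> (G_gen n 1 \<otimes>\<^bsub>G_group n\<^esub> G_gen n 2))"
      by (simp add: expression_value_def)
    also have "\<dots> = G_gen n 2 \<otimes>\<^bsub>G_group n\<^esub> (G_gen n 1 \<otimes>\<^bsub>G_group n\<^esub> G_gen n 1) \<otimes>\<^bsub>G_group n\<^esub> G_gen n 2"
      using assms by (simp add: m_assoc)
    finally show "G_gen n 1 \<otimes>\<^bsub>G_group n\<^esub> G_gen n 1 =
        G_gen n 2 \<otimes>\<^bsub>G_group n\<^esub> (G_gen n 1 \<otimes>\<^bsub>G_group n\<^esub> G_gen n 1) \<otimes>\<^bsub>G_group n\<^esub> G_gen n 2" .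
  qed
qed

lemma carrier_G_group: "carrier (G_group n) = generate (G_group n) (G_gen n ` {1..n - 1})"
proof
  interpret group "G_group n" by (rule group_G_group)
  let ?S = "{1..n - 1}" and ?E = "G_relations n"
  have gens: "G_gen n ` ?S \<subseteq> carrier (G_group n)" using G_gen_closed by auto
  show "generate (G_group n) (G_gen n ` ?S) \<subseteq> carrier (G_group n)" by (rule generate_incl[OF gens])
  have letter: "pres_rel ?S ?E `` {[(a, b)]} \<in> generate (G_group n) (G_gen n ` ?S)" if a: "a \<in> ?S" for a b
  proof (cases b)
    case True
    then show ?thesis using a by (auto simp: G_gen_def pres_gen_def intro: generate.incl)
  next
    case False
    have "pres_rel ?S ?E `` {[(a, False)]} \<otimes>\<^bsub>G_group n\<^esub> G_gen n a = \<one>\<^bsub>G_group n\<^esub>"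
      unfolding G_group_def G_gen_def pres_gen_def using a pres_cong.cancel[OF a, of ?E False]
      by (simp add: pres_mult pres_one pres_class_eq_iff del: atLeastAtMost_iff)
    moreover have "pres_rel ?S ?E `` {[(a, False)]} \<in> carrier (G_group n)"
      unfolding G_group_def using a by simp
    ultimately have "pres_rel ?S ?E `` {[(a, False)]} = inv\<^bsub>G_group n\<^esub> G_gen n a"
      using G_gen_closed[OF a] inv_equality by metis
    then show ?thesis using False a by (auto intro: generate.inv)
  qed
  have "pres_rel ?S ?E `` {w} \<in> generate (G_group n) (G_gen n ` ?S)" if "w \<in> words_over ?S" for w
    using that
  proof (induction w)
    case Nil
    show ?case using generate.one[of "G_group n"] by (simp add: G_group_def pres_one)
  next
    case (Cons p w)
    obtain a b where p: "p = (a, b)" by (cases p)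
    have "pres_rel ?S ?E `` {[(a, b)]} \<otimes>\<^bsub>G_group n\<^esub> pres_rel ?S ?E `` {w} = pres_rel ?S ?E `` {p # w}"
      unfolding G_group_def using Cons.prems p by (subst pres_mult) auto
    moreover have "a \<in> ?S" "w \<in> words_over ?S" using Cons.prems p by auto
    ultimately show ?case using generate.eng[OF letter[of a b] Cons.IH] by simp
  qed
  then show "carrier (G_group n) \<subseteq> generate (G_group n) (G_gen n ` ?S)"
    unfolding G_group_def[of n] by (auto elim!: pres_carrierE simp: G_group_def[symmetric])
qed

text \<open>The universal property for the group of bijections of a type. The value of an action on a positive
  word is the composition \<open>foldr f w\<close>, so equality of two words in \<open>G\<close> forces equality of these
  compositions.\<close>

lemma G_group_action:
  fixes f :: "nat \<Rightarrow> 'b \<Rightarrow> 'b"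
  assumes bij: "\<And>i. 1 \<le> i \<Longrightarrow> bij (f i)"
    and braid: "\<And>i. 1 \<le> i \<Longrightarrow> f i \<circ> f (Suc i) \<circ> f i = f (Suc i) \<circ> f i \<circ> f (Suc i)"
    and far: "\<And>i j. 1 \<le> i \<Longrightarrow> i + 2 \<le> j \<Longrightarrow> f i \<circ> f j = f j \<circ> f i"
    and square: "f 1 \<circ> f 1 = f 2 \<circ> f 1 \<circ> f 1 \<circ> f 2"
    and u: "set u \<subseteq> {1..n - 1}" and v: "set v \<subseteq> {1..n - 1}"
    and eq: "expression_value n u = expression_value n v"
  shows "foldr f u = foldr f v"
proof -
  let ?B = "BijGroup (UNIV :: 'b set)"
  have Bij: "Bij (UNIV :: 'b set) = {g. bij g}" by (auto simp: Bij_def)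
  have fB: "f \<in> {1..n - 1} \<rightarrow> carrier ?B" using bij by (auto simp: BijGroup_def Bij)
  have bij_foldr: "bij (foldr f w)" if "\<forall>i\<in>set w. 1 \<le> i" for w
    using that by (induction w) (auto simp: bij intro: bij_comp)
  have one: "\<one>\<^bsub>?B\<^esub> = id" by (auto simp: BijGroup_def)
  have mult: "g \<otimes>\<^bsub>?B\<^esub> h = g \<circ> h" if "bij g" "bij h" for g h
    using that by (auto simp: BijGroup_def Bij compose_def)
  have val: "word_value ?B f (pos_word w) = foldr f w" if "\<forall>i\<in>set w. 1 \<le> i" for w
    using that
  proof (induction w)
    case Nil
    show ?case by (simp add: pos_word_def one)
  next
    case (Cons i w)
    then have "bij (f i)" "bij (foldr f w)" using bij bij_foldr by auto
    moreover have "word_value ?B f (pos_word w) = foldr f w" using Cons by simp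
    ultimately show ?case by (simp add: pos_word_def mult)
  qed
  have rel: "word_value ?B f u = word_value ?B f v" if uv: "(u, v) \<in> G_relations n" for u v
  proof -
    have far': "f i \<circ> f j = f j \<circ> f i" if "1 \<le> i" "1 \<le> j" "\<bar>int i - int j\<bar> \<ge> 2" for i j
      using far[of i j] far[of j i] that by (cases "i \<le> j") auto
    consider i where "1 \<le> i" "u = pos_word [i, Suc i, i]" "v = pos_word [Suc i, i, Suc i]"
      | i j where "1 \<le> i" "1 \<le> j" "\<bar>int i - int j\<bar> \<ge> 2" "u = pos_word [i, j]" "v = pos_word [j, i]"
      | "u = pos_word [1, 1]" "v = pos_word [2, 1, 1, 2]"
      using uv unfolding G_relations_def by auto
    then show ?thesis
    proof cases
      case 1
      then show ?thesis using braid[of i] by (simp add: val o_assoc)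
    next
      case 2
      then show ?thesis using far'[of i j] by (simp add: val)
    next
      case 3
      have "foldr f [2, 1, 1, 2] = f 2 \<circ> f 1 \<circ> f 1 \<circ> f 2" by (simp add: o_assoc)
      also have "\<dots> = f 1 \<circ> f 1" by (rule square[symmetric])
      also have "\<dots> = foldr f [1, 1]" by simp
      finally show ?thesis using 3 by (simp only: val) (simp add: val)
    qed
  qed
  have "pres_cong {1..n - 1} (G_relations n) (pos_word u) (pos_word v)"
    using eq u v by (simp add: expression_value_class pos_word_in_words_over pres_class_eq_iff)
  from word_value_cong[OF group_BijGroup fB rel this]
  show ?thesis using u v by (simp add: val subset_iff)
qed

section \<open>Signed permutations\<close>

text \<open>The rotation \<open>e\<^sub>i \<mapsto> e\<^sub>i\<^sub>+\<^sub>1 \<mapsto> - e\<^sub>i\<close> as a permutation of signed basis vectors, where the integer \<open>\<plusminus>p\<close>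
  stands for \<open>\<plusminus>e\<^sub>p\<close>.\<close>

definition quarter_turn :: "nat \<Rightarrow> int \<Rightarrow> int" where
  "quarter_turn i x =
    (if x = int i then int i + 1 else if x = int i + 1 then - int i
     else if x = - int i then - (int i + 1) else if x = - (int i + 1) then int i else x)"

lemma quarter_turn_uminus: "1 \<le> i \<Longrightarrow> quarter_turn i (- x) = - quarter_turn i x"
  by (auto simp: quarter_turn_def)

lemma bij_quarter_turn: "1 \<le> i \<Longrightarrow> bij (quarter_turn i)"
  by (rule bij_betw_byWitness[where f' = "\<lambda>x. quarter_turn i (quarter_turn i (quarter_turn i x))"])
    (auto simp: quarter_turn_def)

lemma quarter_turn_action:
  assumes "set u \<subseteq> {1..n - 1}" "set v \<subseteq> {1..n - 1}" "expression_value n u = expression_value n v"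
  shows "foldr quarter_turn u = foldr quarter_turn v"
proof (rule G_group_action[OF bij_quarter_turn _ _ _ assms])
  have braid: "(quarter_turn i \<circ> quarter_turn (Suc i) \<circ> quarter_turn i) x =
      (quarter_turn (Suc i) \<circ> quarter_turn i \<circ> quarter_turn (Suc i)) x"
    and square: "(quarter_turn i \<circ> quarter_turn i) x =
      (quarter_turn (Suc i) \<circ> quarter_turn i \<circ> quarter_turn i \<circ> quarter_turn (Suc i)) x"
    if "1 \<le> i" for i x
  proof -
    consider "x = int i" | "x = int i + 1" | "x = int i + 2" | "x = - int i" | "x = - (int i + 1)"
      | "x = - (int i + 2)" | "x \<noteq> int i" "x \<noteq> int i + 1" "x \<noteq> int i + 2" "x \<noteq> - int i"
          "x \<noteq> - (int i + 1)" "x \<noteq> - (int i + 2)"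
      by blast
    note cases = this
    show "(quarter_turn i \<circ> quarter_turn (Suc i) \<circ> quarter_turn i) x =
      (quarter_turn (Suc i) \<circ> quarter_turn i \<circ> quarter_turn (Suc i)) x"
      using cases that by cases (simp_all add: quarter_turn_def)
    show "(quarter_turn i \<circ> quarter_turn i) x =
      (quarter_turn (Suc i) \<circ> quarter_turn i \<circ> quarter_turn i \<circ> quarter_turn (Suc i)) x"
      using cases that by cases (simp_all add: quarter_turn_def)
  qed
  show "quarter_turn i \<circ> quarter_turn (Suc i) \<circ> quarter_turn i =
      quarter_turn (Suc i) \<circ> quarter_turn i \<circ> quarter_turn (Suc i)" if "1 \<le> i" for i
    using braid[OF that] by (rule ext)
  show "quarter_turn 1 \<circ> quarter_turn 1 = quarter_turn 2 \<circ> quarter_turn 1 \<circ> quarter_turn 1 \<circ> quarter_turn 2"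
    using square[of 1] by (intro ext) (simp only: numeral_2_eq_2 One_nat_def order_refl)
  show "quarter_turn i \<circ> quarter_turn j = quarter_turn j \<circ> quarter_turn i" if "1 \<le> i" "i + 2 \<le> j" for i j
  proof
    fix x
    consider "x = int i" | "x = int i + 1" | "x = - int i" | "x = - (int i + 1)"
      | "x = int j" | "x = int j + 1" | "x = - int j" | "x = - (int j + 1)"
      | "x \<noteq> int i" "x \<noteq> int i + 1" "x \<noteq> - int i" "x \<noteq> - (int i + 1)"
        "x \<noteq> int j" "x \<noteq> int j + 1" "x \<noteq> - int j" "x \<noteq> - (int j + 1)"
      by blast
    then show "(quarter_turn i \<circ> quarter_turn j) x = (quarter_turn j \<circ> quarter_turn i) x"
      using that by cases (simp_all add: quarter_turn_def)
  qed
qed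

lemma bij_foldr_quarter_turn: "0 \<notin> set w \<Longrightarrow> bij (foldr quarter_turn w)"
  by (induction w) (auto intro!: bij_comp bij_quarter_turn simp: Suc_le_eq)

lemma foldr_quarter_turn_fixes:
  "set w \<subseteq> {1..k} \<Longrightarrow> foldr quarter_turn w (int k + 2) = int k + 2"
  by (induction w) (auto simp: quarter_turn_def)

lemma foldr_quarter_turn_descending:
  assumes "p \<le> Suc k"
  shows "foldr quarter_turn (rev [p..<Suc k]) (int p) = int k + 1"
  using assms
proof (induction k)
  case (Suc k)
  then show ?case by (cases "p = Suc (Suc k)") (auto simp: quarter_turn_def)
qed (auto simp: quarter_turn_def le_Suc_eq)

lemma foldr_quarter_turn_uminus: "0 \<notin> set w \<Longrightarrow> foldr quarter_turn w (- x) = - foldr quarter_turn w x"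
  by (induction w) (auto simp: quarter_turn_uminus Suc_le_eq)

text \<open>A factor \<open>y\<^sub>(\<^sub>k\<^sub>)\<close> is recovered from the vector \<open>\<plusminus>e\<^sub>p\<close> that it sends to \<open>e\<^sub>k\<^sub>+\<^sub>1\<close>: the index \<open>p\<close> says where
  the descending word ends, the sign whether there is an additional square in front.\<close>

lemma factor_expression_determined:
  assumes k: "1 \<le> k" and w: "w \<in> factor_expressions k" and x: "foldr quarter_turn w x = int k + 1"
  shows "w = (if 0 < x then rev [nat x..<Suc k] else k # k # rev [nat (- x)..<Suc k])"
proof -
  have "0 \<notin> set w" using factor_expressions_subset[OF k w] by auto
  then have inj: "inj (foldr quarter_turn w)" using bij_foldr_quarter_turn bij_is_inj by blast
  from w consider p where "p \<in> {1..Suc k}" "w = rev [p..<Suc k]"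
    | p where "p \<in> {1..Suc k}" "w = k # k # rev [p..<Suc k]"
    unfolding factor_expressions_eq[OF k] by blast
  then show ?thesis
  proof cases
    case 1
    then have "foldr quarter_turn w (int p) = int k + 1"
      using foldr_quarter_turn_descending[of p k] by (simp del: upt_Suc)
    then have "x = int p" using x inj by (metis injD)
    then show ?thesis using 1 by (simp del: upt_Suc)
  next
    case 2
    have "foldr quarter_turn (rev [p..<Suc k]) (- int p) = - (int k + 1)"
      using 2 foldr_quarter_turn_descending[of p k]
      by (subst foldr_quarter_turn_uminus) (auto simp del: upt_Suc)
    then have "foldr quarter_turn w (- int p) = int k + 1"
      using 2 k by (simp add: quarter_turn_def del: upt_Suc)
    then have "x = - int p" using x inj by (metis injD)
    then show ?thesis using 2 by (simp del: upt_Suc)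
  qed
qed

section \<open>The spin representation\<close>

text \<open>These operators represent the products \<open>e\<^sub>i e\<^sub>i\<^sub>+\<^sub>1\<close> of a Clifford algebra. Flipping the bit \<open>i\<close> changes
  the sign that compares the bits \<open>i\<close> and \<open>i + 1\<close>, which makes the operator a square root of \<open>- 1\<close>.
  The sign of the operator with index \<open>i\<close> also depends on the bit \<open>i + 1\<close>, which the
  operator with index \<open>i + 1\<close> flips, whereas no other operator flips a bit that its sign depends on:
  this is why exactly the adjacent operators anticommute.\<close>

definition clifford :: "nat \<Rightarrow> ((nat \<Rightarrow> bool) \<Rightarrow> real) \<Rightarrow> (nat \<Rightarrow> bool) \<Rightarrow> real" where
  "clifford i f A = (if A i = A (Suc i) then 1 else - 1) * f (A(i := \<not> A i))"

text \<open>Rotation by a quarter turn is \<open>exp (\<pi>/4 J) = (1 + J) / \<surd>2\<close> in the spin group.\<close>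

definition spin :: "nat \<Rightarrow> ((nat \<Rightarrow> bool) \<Rightarrow> real) \<Rightarrow> (nat \<Rightarrow> bool) \<Rightarrow> real" where
  "spin i f A = (f A + clifford i f A) / sqrt 2"

lemma clifford_clifford: "clifford i (clifford i f) = (\<lambda>A. - f A)"
  by (auto simp: clifford_def fun_eq_iff)

lemma clifford_anticommute: "clifford i (clifford (Suc i) f) = (\<lambda>A. - clifford (Suc i) (clifford i f) A)"
  by (auto simp: clifford_def fun_eq_iff fun_upd_twist)

lemma clifford_commute: "i + 2 \<le> j \<Longrightarrow> clifford i (clifford j f) = clifford j (clifford i f)"
  by (auto simp: clifford_def fun_eq_iff fun_upd_twist)

lemma spin_eq: "spin i f = (\<lambda>A. (f A + clifford i f A) / sqrt 2)"
  by (intro ext) (rule spin_def)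

lemma clifford_linear:
  "clifford i (\<lambda>A. f A + g A) = (\<lambda>A. clifford i f A + clifford i g A)"
  "clifford i (\<lambda>A. f A - g A) = (\<lambda>A. clifford i f A - clifford i g A)"
  "clifford i (\<lambda>A. - f A) = (\<lambda>A. - clifford i f A)"
  "clifford i (\<lambda>A. f A / a) = (\<lambda>A. clifford i f A / a)"
  by (auto simp: clifford_def fun_eq_iff)

lemma sqrt_2_quotients: "x / sqrt 2 + y / sqrt 2 = (x + y) / sqrt 2" "x / sqrt 2 / sqrt 2 = x / 2"
  by (simp_all add: add_divide_distrib)

lemmas spin_calculus = spin_eq clifford_linear clifford_clifford sqrt_2_quotients

text \<open>All identities between the operators \<open>spin\<close> follow by expanding them linearly and moving the
  operators \<open>clifford\<close> into a fixed order.\<close>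

lemma spin_spin: "spin i (spin i f) = clifford i f"
  by (intro ext) (simp add: spin_calculus)

lemma spin_braid: "spin i (spin (Suc i) (spin i f)) = spin (Suc i) (spin i (spin (Suc i) f))"
proof -
  have anti: "clifford (Suc i) (clifford i f) = (\<lambda>A. - clifford i (clifford (Suc i) f) A)" for f
    by (simp add: clifford_anticommute)
  show ?thesis by (intro ext) (simp add: spin_calculus anti field_simps)
qed

lemma spin_commute:
  assumes "i + 2 \<le> j"
  shows "spin i (spin j f) = spin j (spin i f)"
  using clifford_commute[OF assms, of f] by (intro ext) (simp add: spin_calculus)

lemma spin_square: "clifford i f = spin (Suc i) (clifford i (spin (Suc i) f))"
proof -
  have anti: "clifford (Suc i) (clifford i f) = (\<lambda>A. - clifford i (clifford (Suc i) f) A)" for f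
    by (simp add: clifford_anticommute)
  show ?thesis by (intro ext) (simp add: spin_calculus anti)
qed

lemma bij_spin: "bij (spin i)"
  \<comment> \<open>The inverse is the seventh power, with \<open>clifford i\<close> standing for the square.\<close>
proof (rule bij_betw_byWitness[where f' = "\<lambda>f. spin i (clifford i (clifford i (clifford i f)))"])
  have eq: "clifford i (clifford i (clifford i (clifford i f))) = f" for f by (simp add: clifford_clifford)
  then have "spin i (spin i (spin i (spin i (spin i (spin i (spin i (spin i f))))))) = f" for f
    by (simp add: spin_spin)
  then show "\<forall>f\<in>UNIV. spin i (clifford i (clifford i (clifford i (spin i f)))) = f"
      "\<forall>f\<in>UNIV. spin i (spin i (clifford i (clifford i (clifford i f)))) = f"
    by (simp_all add: spin_spin[symmetric])
qed auto

lemma spin_action: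
  assumes "set u \<subseteq> {1..n - 1}" "set v \<subseteq> {1..n - 1}" "expression_value n u = expression_value n v"
  shows "foldr spin u = foldr spin v"
proof (rule G_group_action[OF bij_spin _ _ _ assms])
  show "spin i \<circ> spin (Suc i) \<circ> spin i = spin (Suc i) \<circ> spin i \<circ> spin (Suc i)" for i
    by (intro ext) (simp add: spin_braid)
  show "spin i \<circ> spin j = spin j \<circ> spin i" if "i + 2 \<le> j" for i j
    using spin_commute[OF that] by (intro ext) simp
  show "spin 1 \<circ> spin 1 = spin 2 \<circ> spin 1 \<circ> spin 1 \<circ> spin 2"
  proof
    fix f
    have "(spin 1 \<circ> spin 1) f = clifford 1 f" by (simp add: spin_spin)
    also have "\<dots> = spin 2 (clifford 1 (spin 2 f))" using spin_square[of 1 f] by (simp only: numeral_2_eq_2 One_nat_def)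
    also have "\<dots> = (spin 2 \<circ> spin 1 \<circ> spin 1 \<circ> spin 2) f" by (simp add: spin_spin)
    finally show "(spin 1 \<circ> spin 1) f = (spin 2 \<circ> spin 1 \<circ> spin 1 \<circ> spin 2) f" .
  qed
qed

section \<open>Uniqueness and the order of the group\<close>

lemma (in group) power_inj_of_order_8:
  assumes x: "x \<in> carrier G" and e: "x [^] (8::nat) = \<one>" "x [^] (4::nat) \<noteq> \<one>"
    and m: "m \<le> 7" "m' \<le> 7" and eq: "x [^] (m::nat) = x [^] (m'::nat)"
  shows "m = m'"
proof -
  have "ord x dvd 2 ^ 3" "\<not> ord x dvd 2 ^ 2" using x e pow_eq_id by auto
  then obtain i where "i \<le> 3" "ord x = 2 ^ i" "\<not> i \<le> 2"
    using divides_primepow_nat[of 2 "ord x" 3] le_imp_power_dvd by (metis two_is_prime_nat)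
  then have "ord x = 2 ^ 3" by (metis eq_iff not_less_eq_eq numeral_2_eq_2 numeral_3_eq_3)
  then have "ord x = 8" by simp
  then show ?thesis using ord_inj[OF x] m eq by (auto dest: inj_onD)
qed

lemma expression_value_replicate:
  assumes "n \<ge> 3"
  shows "expression_value n (replicate m 1) = G_gen n 1 [^]\<^bsub>G_group n\<^esub> m"
proof -
  interpret group "G_group n" by (rule group_G_group)
  have 1: "G_gen n 1 \<in> carrier (G_group n)" using assms by (intro G_gen_closed) auto
  show ?thesis
  proof (induction m)
    case (Suc m)
    then show ?case using nat_pow_Suc2[OF 1, of m] by (simp add: expression_value_def)
  qed (simp add: expression_value_def)
qed

lemma expression_value_append:
  assumes "set u \<subseteq> {1..n - 1}" "set v \<subseteq> {1..n - 1}"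
  shows "expression_value n (u @ v) = expression_value n u \<otimes>\<^bsub>G_group n\<^esub> expression_value n v"
proof -
  interpret group "G_group n" by (rule group_G_group)
  show ?thesis unfolding expression_value_def map_append
    by (rule list_prod_append) (use assms G_gen_closed in auto)
qed

lemma expression_value_closed:
  assumes "set w \<subseteq> {1..n - 1}"
  shows "expression_value n w \<in> carrier (G_group n)"
proof -
  interpret group "G_group n" by (rule group_G_group)
  show ?thesis unfolding expression_value_def
    by (rule list_prod_closed) (use assms G_gen_closed in auto)
qed

lemma expression_value_concat:
  assumes "\<And>w. w \<in> set ws \<Longrightarrow> set w \<subseteq> {1..n - 1}"
  shows "expression_value n (concat ws) = list_prod (G_group n) (map (expression_value n) ws)"
  using assms
proof (induction ws)
  case (Cons w ws)
  then have "set (concat ws) \<subseteq> {1..n - 1}" by auto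
  then show ?case using Cons by (simp add: expression_value_append)
qed (simp add: expression_value_def)

lemma canonical_value_word:
  assumes "n \<ge> 3" and y: "\<And>i. i \<in> {2..n - 1} \<Longrightarrow> y i \<in> factor_expressions i"
  shows "canonical_value n (m, y) = expression_value n (canonical_word (n - 1) m y)"
proof -
  have sub: "set w \<subseteq> {1..n - 1}" if "w \<in> set (map y [2..<n])" for w
  proof -
    from that obtain i where "i \<in> set [2..<n]" and w: "w = y i" by auto
    then have i: "i \<in> {2..n - 1}" by auto
    then have "set w \<subseteq> {1..i}" using y[OF i] factor_expressions_subset[of i w] w by simp
    also have "\<dots> \<subseteq> {1..n - 1}" using i by auto
    finally show ?thesis .
  qed
  then have "set (concat (map y [2..<n])) \<subseteq> {1..n - 1}" unfolding set_concat by blast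
  moreover have "set (replicate m 1) \<subseteq> {1..n - 1}" using assms(1) by auto
  ultimately have "expression_value n (replicate m 1 @ concat (map y [2..<n])) = canonical_value n (m, y)"
    using expression_value_concat[of "map y [2..<n]", OF sub] expression_value_replicate[OF assms(1)]
    by (simp add: expression_value_append canonical_value_def o_def)
  then show ?thesis using assms(1) by (simp add: canonical_word_def)
qed

text \<open>The fourth power of \<open>R\<^sub>1\<close> is not \<open>1\<close>, because it acts as \<open>- 1\<close> in the spin representation.\<close>

lemma generator_power_inj:
  assumes "n \<ge> 3" "m \<le> 7" "m' \<le> 7"
    and eq: "expression_value n (replicate m 1) = expression_value n (replicate m' 1)"
  shows "m = m'"
proof -
  interpret braid_square_group "G_group n" "G_gen n" "n - 1" by (rule braid_square_group_G_group) fact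
  have "foldr spin (replicate 4 1) (\<lambda>_. 1) \<noteq> foldr spin [] (\<lambda>_. 1)"
    by (simp add: eval_nat_numeral spin_spin clifford_clifford fun_eq_iff)
  then have "expression_value n (replicate 4 1) \<noteq> expression_value n []"
    using spin_action[of "replicate 4 1" n "[]"] assms(1) by auto
  then have "G_gen n 1 [^]\<^bsub>G_group n\<^esub> (4::nat) \<noteq> \<one>\<^bsub>G_group n\<^esub>"
    using expression_value_replicate[OF assms(1), of 4] by (simp add: expression_value_def)
  then show ?thesis
  proof (rule power_inj_of_order_8[rotated 2])
    show "G_gen n 1 \<in> carrier (G_group n)" using R_closed[of 1] assms(1) by simp
    show "G_gen n 1 [^]\<^bsub>G_group n\<^esub> (8::nat) = \<one>\<^bsub>G_group n\<^esub>"
      using eighth_power[of 1] assms(1) by simp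
    show "G_gen n 1 [^]\<^bsub>G_group n\<^esub> m = G_gen n 1 [^]\<^bsub>G_group n\<^esub> m'"
      using eq by (simp only: expression_value_replicate[OF assms(1)])
  qed (use assms in simp_all)
qed

text \<open>The last factor is read off from the vector that the product sends to \<open>e\<^sub>k\<^sub>+\<^sub>2\<close>, the index of the last
  factor being \<open>k + 1\<close> in the induction step; after cancelling it the induction hypothesis
  applies. What remains at the end is decided by the order of \<open>R\<^sub>1\<close>.\<close>

lemma canonical_word_unique:
  assumes "n \<ge> 3" "1 \<le> k" "k \<le> n - 1" "m \<le> 7" "m' \<le> 7"
    and "\<And>i. i \<in> {2..k} \<Longrightarrow> y i \<in> factor_expressions i"
    and "\<And>i. i \<in> {2..k} \<Longrightarrow> y' i \<in> factor_expressions i"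
    and "expression_value n (canonical_word k m y) = expression_value n (canonical_word k m' y')"
  shows "m = m' \<and> (\<forall>i\<in>{2..k}. y i = y' i)"
  using assms(2,3,6-)
proof (induction k rule: dec_induct)
  case base
  have "canonical_word 1 m y = replicate m 1" for m y by (simp add: canonical_word_def)
  then have "m = m'" using generator_power_inj[OF assms(1,4,5)] base.prems(4) by (simp only:)
  then show ?case by simp
next
  case (step k)
  interpret group "G_group n" by (rule group_G_group)
  define u u' v v' where "u = canonical_word k m y" and "u' = canonical_word k m' y'"
    and "v = y (Suc k)" and "v' = y' (Suc k)"
  note defs = this
  have v: "v \<in> factor_expressions (Suc k)" "v' \<in> factor_expressions (Suc k)"
    using step.prems(2,3)[of "Suc k"] step.hyps(1) by (simp_all add: defs)
  have u: "set u \<subseteq> {1..k}" "set u' \<subseteq> {1..k}"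
    unfolding defs using step.prems(2,3) step.hyps(1) by (intro set_canonical_word; simp)+
  have vs: "set v \<subseteq> {1..Suc k}" "set v' \<subseteq> {1..Suc k}"
    using factor_expressions_subset v by auto
  have sub: "set u \<subseteq> {1..n - 1}" "set u' \<subseteq> {1..n - 1}" "set v \<subseteq> {1..n - 1}" "set v' \<subseteq> {1..n - 1}"
    using u vs step.prems(1) by (auto dest!: subsetD)
  have eq: "expression_value n (u @ v) = expression_value n (u' @ v')"
    using step.prems(4) by (simp only: canonical_word_Suc[OF step.hyps(1)] defs)
  have act: "foldr quarter_turn u (foldr quarter_turn v x) = foldr quarter_turn u' (foldr quarter_turn v' x)" for x
    using quarter_turn_action[OF _ _ eq] sub by (simp add: fun_eq_iff)
  have "0 \<notin> set v" "0 \<notin> set u'" using vs u by (auto dest: subsetD)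
  then have surj: "surj (foldr quarter_turn v)" and inj: "inj (foldr quarter_turn u')"
    by (simp_all add: bij_foldr_quarter_turn bij_is_surj bij_is_inj)
  \<comment> \<open>The words \<open>u\<close> and \<open>u'\<close> fix \<open>k + 2\<close>, so \<open>v\<close> and \<open>v'\<close> send the same signed index \<open>x\<close> to it.\<close>
  obtain x where "int k + 2 = foldr quarter_turn v x" using surj by (rule surjE)
  then have x: "foldr quarter_turn v x = int k + 2" by simp
  then have "foldr quarter_turn u' (foldr quarter_turn v' x) = foldr quarter_turn u' (int k + 2)"
    using act[of x] foldr_quarter_turn_fixes[OF u(1)] foldr_quarter_turn_fixes[OF u(2)] by (simp only: x)
  then have x': "foldr quarter_turn v' x = int k + 2" by (rule injD[OF inj])
  have vv: "v = v'"
    using factor_expression_determined[OF _ v(1), of x] factor_expression_determined[OF _ v(2), of x] x x'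
    by (simp del: upt_Suc)
  then have "expression_value n u = expression_value n u'"
    using eq sub expression_value_closed[of _ n] by (simp add: expression_value_append)
  then have "m = m' \<and> (\<forall>i\<in>{2..k}. y i = y' i)"
    using step.prems(1) by (intro step.IH step.prems(2,3)) (simp_all add: defs)
  then show ?case using vv by (auto simp: defs le_Suc_eq)
qed

theorem proposition5:
  fixes n :: nat
  assumes "n \<ge> 3"
  shows "(\<forall>x\<in>carrier (G_group n). \<exists>!p. p \<in> canonical_forms n \<and> x = canonical_value n p)
    \<and> order (G_group n) = 2 ^ n * fact n"
proof -
  interpret braid_square_group "G_group n" "G_gen n" "n - 1" by (rule braid_square_group_G_group) fact
  have val: "canonical_value n (m, y) = expression_value n (canonical_word (n - 1) m y)"
    "canonical_value n (m, y) \<in> carrier (G_group n)"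
    if "(m, y) \<in> canonical_forms n" for m y
  proof -
    have y: "y i \<in> factor_expressions i" if "i \<in> {2..n - 1}" for i
      using \<open>(m, y) \<in> _\<close> that by (auto simp: canonical_forms_def)
    show eq: "canonical_value n (m, y) = expression_value n (canonical_word (n - 1) m y)"
      using assms y by (rule canonical_value_word)
    show "canonical_value n (m, y) \<in> carrier (G_group n)"
      unfolding eq using assms y by (intro expression_value_closed set_canonical_word) auto
  qed
  have inj: "inj_on (canonical_value n) (canonical_forms n)"
  proof (rule inj_onI)
    fix p p' assume p: "p \<in> canonical_forms n" "p' \<in> canonical_forms n"
      and eq: "canonical_value n p = canonical_value n p'"
    obtain m y m' y' where my: "p = (m, y)" "p' = (m', y')" by fastforce
    have y: "y \<in> (\<Pi>\<^sub>E i\<in>{2..n - 1}. factor_expressions i)" "y' \<in> (\<Pi>\<^sub>E i\<in>{2..n - 1}. factor_expressions i)"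
      using p by (auto simp: my canonical_forms_def)
    have "m = m' \<and> (\<forall>i\<in>{2..n - 1}. y i = y' i)"
      by (rule canonical_word_unique[OF assms])
        (use assms p eq val(1)[of m y] val(1)[of m' y'] PiE_mem[OF y(1)] PiE_mem[OF y(2)] in
          \<open>simp_all add: my canonical_forms_def\<close>)
    then show "p = p'" using PiE_ext[OF y] by (simp add: my)
  qed
  have image: "canonical_value n ` canonical_forms n = carrier (G_group n)"
  proof
    show "canonical_value n ` canonical_forms n \<subseteq> carrier (G_group n)" using val by auto
    show "carrier (G_group n) \<subseteq> canonical_value n ` canonical_forms n"
    proof
      fix x assume "x \<in> carrier (G_group n)"
      then have "x \<in> parabolic (n - 1)" by (simp add: carrier_G_group parabolic_def)
      then obtain m y where my: "m \<le> 7" "y \<in> (\<Pi>\<^sub>E i\<in>{2..n - 1}. factor_expressions i)"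
          "x = expression_value n (canonical_word (n - 1) m y)"
        using canonical_form_exists[of "n - 1" x] assms unfolding expression_value_def by fastforce
      then have "(m, y) \<in> canonical_forms n" by (simp add: canonical_forms_def)
      moreover from this have "x = canonical_value n (m, y)" using my(3) val(1) by simp
      ultimately show "x \<in> canonical_value n ` canonical_forms n" by (rule rev_image_eqI)
    qed
  qed
  have "order (G_group n) = 2 ^ n * fact n"
    using card_image[OF inj] card_canonical_forms[of n] assms by (simp add: image order_def)
  moreover have "\<exists>!p. p \<in> canonical_forms n \<and> x = canonical_value n p" if "x \<in> carrier (G_group n)" for x
    using that inj unfolding image[symmetric] by (auto dest: inj_onD)
  ultimately show ?thesis by blast
qed

end
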